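(* If $x^*$ satisfies the AKKT2 conditions for the problem (SOCP) and fulfills Robinson CQ and the weak constant rank (WCR) property, then there exist multipliers $\mu^*\in\mathbb{R}^p$ and $\omega^*\in\mathcal{K}$ such that $x^*$ satisfies the weak second-order necessary condition (WSONC) with $\mu^*$ and $\omega^*$.
   Context: Problem (SOCP): minimize $f(x)$ over $x\in\mathbb{R}^n$ subject to $g_i(x)\in\mathcal{K}_i$ ($i=1,\dots,r$) and $h(x)=0$, where $f:\mathbb{R}^n\to\mathbb{R}$, $h:\mathbb{R}^n\to\mathbb{R}^p$, $g_i:\mathbb{R}^n\to\mathbb{R}^{m_i}$ are twice continuously differentiable. A vector $w\in\mathbb{R}^\ell$ is written $w=(w_0,\overline{w})\in\mathbb{R}\times\mathbb{R}^{\ell-1}$, and $[w]_0:=w_0$. $\mathcal{K}_i:=\{(w_0,\overline w)\in\mathbb{R}\times\mathbb{R}^{m_i-1}\mid w_0\ge\|\overline w\|\}$ if $m_i>1$ and $\mathcal{K}_i:=\{w\in\mathbb{R}\mid w\ge0\}$ if $m_i=1$; $\mathcal{K}:=\mathcal{K}_1\times\dots\times\mathcal{K}_r$, $g:=(g_1,\dots,g_r)$. $\|\cdot\|$ is the Euclidean norm; $D$ denotes the Jacobian (rows are transposed gradients). $\mathrm{int}(\mathcal{K}_i)$ is the set where $w_0>\|\overline w\|$, and $\mathrm{bd}^+(\mathcal{K}_i)$ the set where $w_0=\|\overline w\|\ne0$. For feasible $x$: $I_0(x):=\{i\mid g_i(x)=0\}$, $I_B(x):=\{i\mid g_i(x)\in\mathrm{bd}^+(\mathcal{K}_i)\}$,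 $I_I(x):=\{i\mid g_i(x)\in\mathrm{int}(\mathcal{K}_i)\}$. Lagrangian: $L(x,\mu,\omega):=f(x)+\langle h(x),\mu\rangle-\langle g(x),\omega\rangle$ for $\mu\in\mathbb{R}^p$, $\omega=(\omega_1,\dots,\omega_r)\in\mathcal{K}$; $\nabla_x L,\nabla_x^2L$ are its gradient and Hessian in $x$. $(x,\mu,\omega)$ with $\mu\in\mathbb{R}^p$, $\omega\in\mathcal{K}$ is a KKT triple if $x$ is feasible, $\nabla_xL(x,\mu,\omega)=0$ and $\langle g_i(x),\omega_i\rangle=0$ for all $i$. $\Gamma_i:=\begin{pmatrix}1&0^\top\\0&-I_{m_i-1}\end{pmatrix}$, $\tilde g_i(x):=(\|\overline{g_i(x)}\|,\overline{g_i(x)})$, and, relative to $x^*$, $\sigma(x,\omega):=\sum_{i\in I_B(x^* )}-\frac{[\omega_i]_0}{[g_i(x)]_0}Dg_i(x)^\top\Gamma_iDg_i(x)$. Robinson CQ at a feasible $x$: $Dh(x)$ has full row rank and there is $d\in\mathbb{R}^n$ with $g_i(x)+Dg_i(x)d\in\mathrm{int}(\mathcal{K}_i)$ for all $i$ and $Dh(x)d=0$. WCR property at a feasible $x^*$: there is a neighborhood $\mathcal{N}$ of $x^*$ such that the family $\{\nabla h_i(x)\}_{i=1,\dots,p}\cup\{\nabla g_{ij}(x)\}_{i\in I_0(x^* ),\,j=1,\dots,m_i}\cup\{Dg_i(x)^\top\Gamma_i\tilde g_i(x)\}_{i\in I_B(x^* )}$ has the same rank for all $x\in\mathcal{N}$,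 where $g_{ij}$ is the $j$-th component of $g_i$. WSONC at $x^*$ with multipliers $\mu^*,\omega^*$: $(x^*,\mu^*,\omega^* )$ is a KKT triple and $d^\top(\nabla_x^2L(x^*,\mu^*,\omega^* )+\sigma(x^*,\omega^* ))d\ge0$ for all $d\in S(x^* ):=\{d\in\mathbb{R}^n\mid Dh(x^* )d=0;\ Dg_i(x^* )d=0,\ i\in I_0(x^* );\ g_i(x^* )^\top\Gamma_iDg_i(x^* )d=0,\ i\in I_B(x^* )\}$. AKKT conditions: sequences $x^k\to x^*$, $\{\mu^k\}\subset\mathbb{R}^p$, $\{\omega^k\}\subset\mathcal{K}$ satisfy the AKKT conditions at a feasible $x^*$ if $\nabla_xL(x^k,\mu^k,\omega^k)\to0$; for $i\in I_I(x^* )$, $\omega_i^k\to0$; and for $i\in I_B(x^* )$, either $\omega_i^k\to0$, or $\omega_i^k\in\mathrm{bd}^+(\mathcal{K}_i)$ for all $k$ with $\overline{\omega_i^k}/\|\overline{\omega_i^k}\|\to-\overline{g_i(x^* )}/\|\overline{g_i(x^* )}\|$. AKKT2 conditions: a feasible point $x^*$ satisfies AKKT2 if there exist sequences $x^k\to x^*$, $\{\mu^k\}\subset\mathbb{R}^p$, $\{\omega^k\}\subset\mathcal{K}$ satisfying the AKKT conditions and, in addition, sequences $\{\eta^k\}\subset\mathbb{R}^p$, $\{\theta_i^k\}\subset\mathbb{R}$ ($i\in I_0(x^* )$), $\{\gamma_i^k\}\subset\mathbb{R}$ ($i\in I_B(x^* )$), $\{\delta_k\}\subset\mathbb{R}_+$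 with $\delta_k\to0$, such that for all sufficiently large $k$ and all $d\in\mathbb{R}^n$, $$d^\top\Big(\nabla_x^2L(x^k,\mu^k,\omega^k)+\sigma(x^k,\omega^k)+\sum_{i=1}^p\eta_i^k\nabla h_i(x^k)\nabla h_i(x^k)^\top+\sum_{i\in I_B(x^* )}\gamma_i^k(Dg_i(x^k)^\top\Gamma_i\tilde g_i(x^k))(Dg_i(x^k)^\top\Gamma_i\tilde g_i(x^k))^\top+\sum_{i\in I_0(x^* )}\theta_i^kDg_i(x^k)^\top Dg_i(x^k)+\delta_kI_n\Big)d\ge0.$$ *)

theory Defs
  imports "HOL-Analysis.Analysis"
begin

text \<open>
  The numbers \<open>p\<close> of equality constraints, \<open>r\<close> of cones, and the cone dimensions \<open>m i\<close> are
  arbitrary natural numbers (\<open>p = 0\<close> and \<open>r = 0\<close> are allowed).  A vector of \<open>\<real>\<^sup>l\<close> with \<open>l\<close> of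
  this kind is a function \<open>w :: nat \<Rightarrow> real\<close> of which only the entries \<open>w 0, \<dots>, w (l - 1)\<close> are
  ever used; \<open>w 0\<close> is the leading entry, and the remaining part is \<open>w 1, \<dots>, w (l - 1)\<close>.
  Accordingly \<open>h x i\<close> is the \<open>i\<close>-th component of \<open>h(x)\<close>, \<open>g i x\<close> is the vector \<open>g\<^sub>i(x)\<close>, and
  \<open>g i x j\<close> its \<open>j\<close>-th component.
\<close>

definition grad :: "(real^'n \<Rightarrow> real) \<Rightarrow> real^'n \<Rightarrow> real^'n" where
  "grad f x = (THE D. GDERIV f x :> D)"

definition hessian :: "(real^'n \<Rightarrow> real) \<Rightarrow> real^'n \<Rightarrow> real^'n^'n" where
  "hessian f x = jacobian (grad f) (at x)"

definition twice_cont_diff :: "(real^'n \<Rightarrow> real) \<Rightarrow> bool" where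
  "twice_cont_diff f \<longleftrightarrow>
     (\<forall>x. f differentiable at x) \<and> (\<forall>x. grad f differentiable at x) \<and>
     continuous_on UNIV (hessian f)"

text \<open>
  For \<open>G :: \<real>\<^sup>n \<rightarrow> \<real>\<^sup>l\<close>, the maps \<open>d \<mapsto> DG(x) d\<close> and \<open>w \<mapsto> DG(x)\<^sup>T w\<close>; the rows of \<open>DG(x)\<close> are
  the transposed gradients of the components of \<open>G\<close>.
\<close>

definition D_app :: "(real^'n \<Rightarrow> nat \<Rightarrow> real) \<Rightarrow> real^'n \<Rightarrow> real^'n \<Rightarrow> nat \<Rightarrow> real" where
  "D_app G x d = (\<lambda>j. grad (\<lambda>y. G y j) x \<bullet> d)"

definition DT_app ::
  "nat \<Rightarrow> (real^'n \<Rightarrow> nat \<Rightarrow> real) \<Rightarrow> real^'n \<Rightarrow> (nat \<Rightarrow> real) \<Rightarrow> real^'n" where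
  "DT_app l G x w = (\<Sum>j<l. w j *\<^sub>R grad (\<lambda>y. G y j) x)"

definition inprod :: "nat \<Rightarrow> (nat \<Rightarrow> real) \<Rightarrow> (nat \<Rightarrow> real) \<Rightarrow> real" where
  "inprod l v w = (\<Sum>j<l. v j * w j)"

definition outer :: "real^'n \<Rightarrow> real^'n^'n" where
  "outer v = (\<chi> i j. v $ i * v $ j)"

definition tail_norm :: "nat \<Rightarrow> (nat \<Rightarrow> real) \<Rightarrow> real" where
  "tail_norm l w = L2_set w {1..<l}"

text \<open>
  For \<open>l = 1\<close> the tail is empty and has norm \<open>0\<close>, so that the cone is the half-line \<open>w\<^sub>0 \<ge> 0\<close>,
  its interior \<open>w\<^sub>0 > 0\<close>, and \<open>soc_bd\<close> is empty.
\<close>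

definition soc :: "nat \<Rightarrow> (nat \<Rightarrow> real) set" where
  "soc l = {w. w 0 \<ge> tail_norm l w}"

definition soc_int :: "nat \<Rightarrow> (nat \<Rightarrow> real) set" where
  "soc_int l = {w. w 0 > tail_norm l w}"

definition soc_bd :: "nat \<Rightarrow> (nat \<Rightarrow> real) set" where
  "soc_bd l = {w. w 0 = tail_norm l w \<and> tail_norm l w \<noteq> 0}"

definition Gam :: "(nat \<Rightarrow> real) \<Rightarrow> nat \<Rightarrow> real" where
  "Gam w = (\<lambda>j. if j = 0 then w j else - w j)"

definition tilde :: "nat \<Rightarrow> (nat \<Rightarrow> real) \<Rightarrow> nat \<Rightarrow> real" where
  "tilde l w = (\<lambda>j. if j = 0 then tail_norm l w else w j)"

definition feasible ::
  "nat \<Rightarrow> (real^'n \<Rightarrow> nat \<Rightarrow> real) \<Rightarrow> nat \<Rightarrow> (nat \<Rightarrow> nat) \<Rightarrow>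
   (nat \<Rightarrow> real^'n \<Rightarrow> nat \<Rightarrow> real) \<Rightarrow> real^'n \<Rightarrow> bool" where
  "feasible p h r m g x \<longleftrightarrow> (\<forall>i<p. h x i = 0) \<and> (\<forall>i<r. g i x \<in> soc (m i))"

definition I0 ::
  "nat \<Rightarrow> (nat \<Rightarrow> nat) \<Rightarrow> (nat \<Rightarrow> real^'n \<Rightarrow> nat \<Rightarrow> real) \<Rightarrow> real^'n \<Rightarrow> nat set" where
  "I0 r m g x = {i. i < r \<and> (\<forall>j<m i. g i x j = 0)}"

definition IB ::
  "nat \<Rightarrow> (nat \<Rightarrow> nat) \<Rightarrow> (nat \<Rightarrow> real^'n \<Rightarrow> nat \<Rightarrow> real) \<Rightarrow> real^'n \<Rightarrow> nat set" where
  "IB r m g x = {i. i < r \<and> g i x \<in> soc_bd (m i)}"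

definition II ::
  "nat \<Rightarrow> (nat \<Rightarrow> nat) \<Rightarrow> (nat \<Rightarrow> real^'n \<Rightarrow> nat \<Rightarrow> real) \<Rightarrow> real^'n \<Rightarrow> nat set" where
  "II r m g x = {i. i < r \<and> g i x \<in> soc_int (m i)}"

definition lagrangian ::
  "(real^'n \<Rightarrow> real) \<Rightarrow> nat \<Rightarrow> (real^'n \<Rightarrow> nat \<Rightarrow> real) \<Rightarrow> nat \<Rightarrow> (nat \<Rightarrow> nat) \<Rightarrow>
   (nat \<Rightarrow> real^'n \<Rightarrow> nat \<Rightarrow> real) \<Rightarrow>
   real^'n \<Rightarrow> (nat \<Rightarrow> real) \<Rightarrow> (nat \<Rightarrow> nat \<Rightarrow> real) \<Rightarrow> real" where
  "lagrangian f p h r m g x \<mu> \<omega> =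
     f x + inprod p (h x) \<mu> - (\<Sum>i<r. inprod (m i) (g i x) (\<omega> i))"

definition grad_L ::
  "(real^'n \<Rightarrow> real) \<Rightarrow> nat \<Rightarrow> (real^'n \<Rightarrow> nat \<Rightarrow> real) \<Rightarrow> nat \<Rightarrow> (nat \<Rightarrow> nat) \<Rightarrow>
   (nat \<Rightarrow> real^'n \<Rightarrow> nat \<Rightarrow> real) \<Rightarrow>
   real^'n \<Rightarrow> (nat \<Rightarrow> real) \<Rightarrow> (nat \<Rightarrow> nat \<Rightarrow> real) \<Rightarrow> real^'n" where
  "grad_L f p h r m g x \<mu> \<omega> = grad (\<lambda>y. lagrangian f p h r m g y \<mu> \<omega>) x"

definition hess_L ::
  "(real^'n \<Rightarrow> real) \<Rightarrow> nat \<Rightarrow> (real^'n \<Rightarrow> nat \<Rightarrow> real) \<Rightarrow> nat \<Rightarrow> (nat \<Rightarrow> nat) \<Rightarrow>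
   (nat \<Rightarrow> real^'n \<Rightarrow> nat \<Rightarrow> real) \<Rightarrow>
   real^'n \<Rightarrow> (nat \<Rightarrow> real) \<Rightarrow> (nat \<Rightarrow> nat \<Rightarrow> real) \<Rightarrow> real^'n^'n" where
  "hess_L f p h r m g x \<mu> \<omega> = hessian (\<lambda>y. lagrangian f p h r m g y \<mu> \<omega>) x"

definition KKT_triple ::
  "(real^'n \<Rightarrow> real) \<Rightarrow> nat \<Rightarrow> (real^'n \<Rightarrow> nat \<Rightarrow> real) \<Rightarrow> nat \<Rightarrow> (nat \<Rightarrow> nat) \<Rightarrow>
   (nat \<Rightarrow> real^'n \<Rightarrow> nat \<Rightarrow> real) \<Rightarrow>
   real^'n \<Rightarrow> (nat \<Rightarrow> real) \<Rightarrow> (nat \<Rightarrow> nat \<Rightarrow> real) \<Rightarrow> bool" where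
  "KKT_triple f p h r m g x \<mu> \<omega> \<longleftrightarrow>
     feasible p h r m g x \<and> (\<forall>i<r. \<omega> i \<in> soc (m i)) \<and>
     grad_L f p h r m g x \<mu> \<omega> = 0 \<and>
     (\<forall>i<r. inprod (m i) (g i x) (\<omega> i) = 0)"

text \<open>
  \<open>sigma r m g xs x \<omega>\<close> is the matrix \<open>\<sigma>(x, \<omega>)\<close> relative to the reference point \<open>xs\<close>.
\<close>

definition sigma ::
  "nat \<Rightarrow> (nat \<Rightarrow> nat) \<Rightarrow> (nat \<Rightarrow> real^'n \<Rightarrow> nat \<Rightarrow> real) \<Rightarrow> real^'n \<Rightarrow>
   real^'n \<Rightarrow> (nat \<Rightarrow> nat \<Rightarrow> real) \<Rightarrow> real^'n^'n" where
  "sigma r m g xs x \<omega> =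
     (\<Sum>i\<in>IB r m g xs. (- (\<omega> i 0 / g i x 0)) *\<^sub>R
        matrix (\<lambda>d. DT_app (m i) (g i) x (Gam (D_app (g i) x d))))"

text \<open>\<open>vB m g i x\<close> is the vector \<open>Dg\<^sub>i(x)\<^sup>T \<Gamma>\<^sub>i g\<^sub>i~(x)\<close>.\<close>

definition vB ::
  "(nat \<Rightarrow> nat) \<Rightarrow> (nat \<Rightarrow> real^'n \<Rightarrow> nat \<Rightarrow> real) \<Rightarrow> nat \<Rightarrow> real^'n \<Rightarrow> real^'n" where
  "vB m g i x = DT_app (m i) (g i) x (Gam (tilde (m i) (g i x)))"

definition robinson_cq ::
  "nat \<Rightarrow> (real^'n \<Rightarrow> nat \<Rightarrow> real) \<Rightarrow> nat \<Rightarrow> (nat \<Rightarrow> nat) \<Rightarrow>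
   (nat \<Rightarrow> real^'n \<Rightarrow> nat \<Rightarrow> real) \<Rightarrow> real^'n \<Rightarrow> bool" where
  "robinson_cq p h r m g x \<longleftrightarrow>
     feasible p h r m g x \<and>
     dim ((\<lambda>i. grad (\<lambda>y. h y i) x) ` {..<p}) = p \<and>
     (\<exists>d. (\<forall>i<r. (\<lambda>j. g i x j + D_app (g i) x d j) \<in> soc_int (m i)) \<and>
          (\<forall>i<p. D_app h x d i = 0))"

text \<open>The rank of a finite family of vectors is the dimension of the span of its members.\<close>

definition wcr_family ::
  "nat \<Rightarrow> (real^'n \<Rightarrow> nat \<Rightarrow> real) \<Rightarrow> nat \<Rightarrow> (nat \<Rightarrow> nat) \<Rightarrow>
   (nat \<Rightarrow> real^'n \<Rightarrow> nat \<Rightarrow> real) \<Rightarrow> real^'n \<Rightarrow> real^'n \<Rightarrow> (real^'n) set" where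
  "wcr_family p h r m g xs x =
     {grad (\<lambda>y. h y i) x | i. i < p} \<union>
     {grad (\<lambda>y. g i y j) x | i j. i \<in> I0 r m g xs \<and> j < m i} \<union>
     {vB m g i x | i. i \<in> IB r m g xs}"

definition WCR ::
  "nat \<Rightarrow> (real^'n \<Rightarrow> nat \<Rightarrow> real) \<Rightarrow> nat \<Rightarrow> (nat \<Rightarrow> nat) \<Rightarrow>
   (nat \<Rightarrow> real^'n \<Rightarrow> nat \<Rightarrow> real) \<Rightarrow> real^'n \<Rightarrow> bool" where
  "WCR p h r m g xs \<longleftrightarrow>
     feasible p h r m g xs \<and>
     (\<exists>N rk. open N \<and> xs \<in> N \<and> (\<forall>x\<in>N. dim (wcr_family p h r m g xs x) = rk))"

definition crit_subspace ::
  "nat \<Rightarrow> (real^'n \<Rightarrow> nat \<Rightarrow> real) \<Rightarrow> nat \<Rightarrow> (nat \<Rightarrow> nat) \<Rightarrow>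
   (nat \<Rightarrow> real^'n \<Rightarrow> nat \<Rightarrow> real) \<Rightarrow> real^'n \<Rightarrow> (real^'n) set" where
  "crit_subspace p h r m g x =
     {d. (\<forall>i<p. D_app h x d i = 0) \<and>
         (\<forall>i\<in>I0 r m g x. \<forall>j<m i. D_app (g i) x d j = 0) \<and>
         (\<forall>i\<in>IB r m g x. inprod (m i) (g i x) (Gam (D_app (g i) x d)) = 0)}"

definition WSONC ::
  "(real^'n \<Rightarrow> real) \<Rightarrow> nat \<Rightarrow> (real^'n \<Rightarrow> nat \<Rightarrow> real) \<Rightarrow> nat \<Rightarrow> (nat \<Rightarrow> nat) \<Rightarrow>
   (nat \<Rightarrow> real^'n \<Rightarrow> nat \<Rightarrow> real) \<Rightarrow>
   real^'n \<Rightarrow> (nat \<Rightarrow> real) \<Rightarrow> (nat \<Rightarrow> nat \<Rightarrow> real) \<Rightarrow> bool" where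
  "WSONC f p h r m g x \<mu> \<omega> \<longleftrightarrow>
     KKT_triple f p h r m g x \<mu> \<omega> \<and>
     (\<forall>d \<in> crit_subspace p h r m g x.
        d \<bullet> ((hess_L f p h r m g x \<mu> \<omega> + sigma r m g x x \<omega>) *v d) \<ge> 0)"

text \<open>
  \<open>xs\<close> is the limit point; \<open>X k\<close>, \<open>\<mu> k\<close> and \<open>\<omega> k\<close> are the \<open>k\<close>-th terms of the sequences, and
  \<open>\<omega> k i j\<close> is component \<open>j\<close> of the \<open>i\<close>-th block of \<open>\<omega> k\<close>.  Convergence in \<open>\<real>\<^sup>l\<close> is expressed
  componentwise.
\<close>

definition AKKT_seq ::
  "(real^'n \<Rightarrow> real) \<Rightarrow> nat \<Rightarrow> (real^'n \<Rightarrow> nat \<Rightarrow> real) \<Rightarrow> nat \<Rightarrow> (nat \<Rightarrow> nat) \<Rightarrow>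
   (nat \<Rightarrow> real^'n \<Rightarrow> nat \<Rightarrow> real) \<Rightarrow> real^'n \<Rightarrow>
   (nat \<Rightarrow> real^'n) \<Rightarrow> (nat \<Rightarrow> nat \<Rightarrow> real) \<Rightarrow> (nat \<Rightarrow> nat \<Rightarrow> nat \<Rightarrow> real) \<Rightarrow> bool" where
  "AKKT_seq f p h r m g xs X \<mu> \<omega> \<longleftrightarrow>
     feasible p h r m g xs \<and>
     X \<longlonglongrightarrow> xs \<and>
     (\<forall>k. \<forall>i<r. \<omega> k i \<in> soc (m i)) \<and>
     (\<lambda>k. grad_L f p h r m g (X k) (\<mu> k) (\<omega> k)) \<longlonglongrightarrow> 0 \<and>
     (\<forall>i\<in>II r m g xs. \<forall>j<m i. (\<lambda>k. \<omega> k i j) \<longlonglongrightarrow> 0) \<and>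
     (\<forall>i\<in>IB r m g xs.
        (\<forall>j<m i. (\<lambda>k. \<omega> k i j) \<longlonglongrightarrow> 0) \<or>
        (\<forall>k. \<omega> k i \<in> soc_bd (m i)) \<and>
        (\<forall>j\<in>{1..<m i}. (\<lambda>k. \<omega> k i j / tail_norm (m i) (\<omega> k i))
            \<longlonglongrightarrow> - (g i xs j / tail_norm (m i) (g i xs))))"

definition AKKT2 ::
  "(real^'n \<Rightarrow> real) \<Rightarrow> nat \<Rightarrow> (real^'n \<Rightarrow> nat \<Rightarrow> real) \<Rightarrow> nat \<Rightarrow> (nat \<Rightarrow> nat) \<Rightarrow>
   (nat \<Rightarrow> real^'n \<Rightarrow> nat \<Rightarrow> real) \<Rightarrow> real^'n \<Rightarrow> bool" where
  "AKKT2 f p h r m g xs \<longleftrightarrow>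
     feasible p h r m g xs \<and>
     (\<exists>X \<mu> \<omega>. AKKT_seq f p h r m g xs X \<mu> \<omega> \<and>
       (\<exists>(\<eta> :: nat \<Rightarrow> nat \<Rightarrow> real) (\<theta> :: nat \<Rightarrow> nat \<Rightarrow> real) (\<gamma> :: nat \<Rightarrow> nat \<Rightarrow> real)
          (\<delta> :: nat \<Rightarrow> real).
          (\<forall>k. \<delta> k \<ge> 0) \<and> \<delta> \<longlonglongrightarrow> 0 \<and>
          (\<forall>\<^sub>F k in sequentially. \<forall>d.
             d \<bullet> ((hess_L f p h r m g (X k) (\<mu> k) (\<omega> k)
                   + sigma r m g xs (X k) (\<omega> k)
                   + (\<Sum>i<p. \<eta> k i *\<^sub>R outer (grad (\<lambda>y. h y i) (X k)))
                   + (\<Sum>i\<in>IB r m g xs. \<gamma> k i *\<^sub>R outer (vB m g i (X k)))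
                   + (\<Sum>i\<in>I0 r m g xs. \<theta> k i *\<^sub>R
                        matrix (\<lambda>v. DT_app (m i) (g i) (X k) (D_app (g i) (X k) v)))
                   + \<delta> k *\<^sub>R mat 1) *v d) \<ge> 0)))"

end

theory Submission
  imports Defs
begin

text \<open>
  The multiplier sequences of the approximate conditions are bounded.  Otherwise, after
  normalisation, they would accumulate at a nonzero abnormal multiplier: one that satisfies
  the stationarity equation without the objective, lies in the cones and is complementary to
  the constraint values.  Robinson's constraint qualification rules this out
  (\<open>robinson_no_abnormal_multiplier\<close>).  Complementarity in the limit is clear for the indices
  where the constraint vanishes or is interior; on the boundary the multiplier either tends
  to zero or aligns with the reflected constraint value (\<open>boundary_limit_complementary\<close>).
  Hence a subsequence of the multipliers converges to KKT multipliers
  (\<open>AKKT_robinson_imp_KKT\<close>).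

  For the second-order condition the coefficients of the rank-one and block terms may be
  unbounded, so these terms must vanish identically before the limit is taken.  This is where
  constant rank enters: every direction \<open>d\<close> of the critical subspace at \<open>xs\<close> is a limit of
  directions \<open>D k\<close> orthogonal to the constant rank family at \<open>X k\<close>, along that subsequence
  (\<open>orthogonal_approximation\<close>, \<open>wcr_approximation\<close>).  Evaluated at \<open>D k\<close>, the inequality
  retains only the Hessian of the Lagrangian, the curvature term \<open>sigma\<close> and the vanishing
  shift \<open>\<delta> k\<close>, all of which pass to the limit.
\<close>

section \<open>Gradients and Hessians\<close>

lemma grad_unique:
  assumes "(F has_derivative (\<lambda>v. D \<bullet> v)) (at x)"
  shows "grad F x = D"
  unfolding grad_def gderiv_def
proof (rule the_equality)
  show "(F has_derivative (\<lambda>v. v \<bullet> D)) (at x)"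
    using assms by (simp add: inner_commute)
next
  fix E assume E: "(F has_derivative (\<lambda>v. v \<bullet> E)) (at x)"
  have "(\<lambda>v. v \<bullet> E) = (\<lambda>v. D \<bullet> v)"
    by (rule has_derivative_unique[OF E assms])
  then have "v \<bullet> E = v \<bullet> D" for v
    by (metis inner_commute)
  then show "E = D"
    by (metis inner_commute vector_eq_ldot)
qed

lemma has_derivative_grad:
  fixes F :: "real^'n \<Rightarrow> real"
  assumes "F differentiable at x"
  shows "(F has_derivative (\<lambda>v. grad F x \<bullet> v)) (at x)"
proof -
  obtain F' where F': "(F has_derivative F') (at x)"
    using assms by (auto simp: differentiable_def)
  have "linear F'"
    using F' by (rule has_derivative_linear)
  then have eq: "F' = (\<lambda>v. adjoint F' 1 \<bullet> v)"
    using adjoint_works[of F'] by (auto simp: fun_eq_iff inner_commute)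
  then have "(F has_derivative (\<lambda>v. adjoint F' 1 \<bullet> v)) (at x)"
    using F' by simp
  then show ?thesis
    using grad_unique by metis
qed

lemma hessian_unique:
  assumes "(grad F has_derivative (\<lambda>v. H *v v)) (at x)"
  shows "hessian F x = H"
  using frechet_derivative_at[OF assms, symmetric]
  by (simp add: hessian_def jacobian_def)

lemma twice_cont_diff_grad:
  "twice_cont_diff F \<Longrightarrow> (F has_derivative (\<lambda>v. grad F x \<bullet> v)) (at x)"
  by (simp add: twice_cont_diff_def has_derivative_grad)

lemma twice_cont_diff_hessian:
  "twice_cont_diff F \<Longrightarrow> (grad F has_derivative (\<lambda>v. hessian F x *v v)) (at x)"
  unfolding twice_cont_diff_def hessian_def using jacobian_works by blast

lemma twice_cont_diff_tendsto:
  assumes "twice_cont_diff F" and "(X \<longlongrightarrow> x) G"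
  shows "((\<lambda>k. F (X k)) \<longlongrightarrow> F x) G"
    and "((\<lambda>k. grad F (X k)) \<longlongrightarrow> grad F x) G"
    and "((\<lambda>k. hessian F (X k)) \<longlongrightarrow> hessian F x) G"
proof -
  have "isCont F x" "isCont (grad F) x" "isCont (hessian F) x"
    using assms(1) unfolding twice_cont_diff_def
    by (auto intro: differentiable_imp_continuous_within simp: continuous_on_eq_continuous_at)
  then show "((\<lambda>k. F (X k)) \<longlongrightarrow> F x) G" "((\<lambda>k. grad F (X k)) \<longlongrightarrow> grad F x) G"
    "((\<lambda>k. hessian F (X k)) \<longlongrightarrow> hessian F x) G"
    using assms(2) by (auto intro: isCont_tendsto_compose)
qed

lemma grad_lagrangian:
  assumes "twice_cont_diff f" "\<forall>i<p. twice_cont_diff (\<lambda>x. h x i)"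
    and "\<forall>i<r. \<forall>j<m i. twice_cont_diff (\<lambda>x. g i x j)"
  shows "grad (\<lambda>y. lagrangian f p h r m g y \<mu> \<omega>) x =
    grad f x + (\<Sum>i<p. \<mu> i *\<^sub>R grad (\<lambda>y. h y i) x) - (\<Sum>i<r. DT_app (m i) (g i) x (\<omega> i))"
proof (rule grad_unique)
  have "((\<lambda>y. lagrangian f p h r m g y \<mu> \<omega>) has_derivative
     (\<lambda>v. grad f x \<bullet> v + (\<Sum>i<p. (grad (\<lambda>y. h y i) x \<bullet> v) * \<mu> i)
        - (\<Sum>i<r. \<Sum>j<m i. (grad (\<lambda>y. g i y j) x \<bullet> v) * \<omega> i j))) (at x)"
    unfolding lagrangian_def inprod_def
    using assms by (intro has_derivative_add has_derivative_diff has_derivative_sum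
        has_derivative_mult_left twice_cont_diff_grad) auto
  then show "((\<lambda>y. lagrangian f p h r m g y \<mu> \<omega>) has_derivative
     (\<lambda>v. (grad f x + (\<Sum>i<p. \<mu> i *\<^sub>R grad (\<lambda>y. h y i) x)
        - (\<Sum>i<r. DT_app (m i) (g i) x (\<omega> i))) \<bullet> v)) (at x)"
    by (simp add: DT_app_def inner_add_left inner_diff_left inner_sum_left mult.commute)
qed

lemma sum_matrix_vector_mult:
  fixes A :: "'b \<Rightarrow> real^'n^'k"
  shows "(\<Sum>i\<in>S. A i) *v v = (\<Sum>i\<in>S. A i *v v)"
  by (induction S rule: infinite_finite_induct) (auto simp: matrix_vector_mult_add_rdistrib)

lemma hess_L_quadratic_form:
  assumes "twice_cont_diff f" "\<forall>i<p. twice_cont_diff (\<lambda>x. h x i)"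
    and "\<forall>i<r. \<forall>j<m i. twice_cont_diff (\<lambda>x. g i x j)"
  shows "d \<bullet> (hess_L f p h r m g x \<mu> \<omega> *v d) =
    d \<bullet> (hessian f x *v d) + (\<Sum>i<p. \<mu> i * (d \<bullet> (hessian (\<lambda>y. h y i) x *v d)))
      - (\<Sum>i<r. \<Sum>j<m i. \<omega> i j * (d \<bullet> (hessian (\<lambda>y. g i y j) x *v d)))"
proof -
  let ?H = "hessian f x + (\<Sum>i<p. \<mu> i *\<^sub>R hessian (\<lambda>y. h y i) x)
      - (\<Sum>i<r. \<Sum>j<m i. \<omega> i j *\<^sub>R hessian (\<lambda>y. g i y j) x)"
  have "((\<lambda>y. grad f y + (\<Sum>i<p. \<mu> i *\<^sub>R grad (\<lambda>y. h y i) y)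
      - (\<Sum>i<r. \<Sum>j<m i. \<omega> i j *\<^sub>R grad (\<lambda>y. g i y j) y)) has_derivative
     (\<lambda>v. hessian f x *v v + (\<Sum>i<p. \<mu> i *\<^sub>R (hessian (\<lambda>y. h y i) x *v v))
      - (\<Sum>i<r. \<Sum>j<m i. \<omega> i j *\<^sub>R (hessian (\<lambda>y. g i y j) x *v v)))) (at x)"
    using assms by (intro has_derivative_add has_derivative_diff has_derivative_sum
        has_derivative_scaleR_right twice_cont_diff_hessian) auto
  then have "(grad (\<lambda>y. lagrangian f p h r m g y \<mu> \<omega>) has_derivative (\<lambda>v. ?H *v v)) (at x)"
    unfolding ext[of "grad (\<lambda>y. lagrangian f p h r m g y \<mu> \<omega>)", OF grad_lagrangian[OF assms]]
    by (simp add: DT_app_def matrix_vector_mult_add_rdistrib matrix_vector_mult_diff_rdistrib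
        sum_matrix_vector_mult scaleR_matrix_vector_assoc)
  then have "hess_L f p h r m g x \<mu> \<omega> = ?H"
    unfolding hess_L_def by (rule hessian_unique)
  then show ?thesis
    by (simp add: matrix_vector_mult_add_rdistrib matrix_vector_mult_diff_rdistrib
        sum_matrix_vector_mult scaleR_matrix_vector_assoc[symmetric] inner_add_right
        inner_diff_right inner_sum_right)
qed

lemma inner_DT_app: "d \<bullet> DT_app l G x w = inprod l (D_app G x d) w"
  by (simp add: DT_app_def D_app_def inprod_def inner_sum_right inner_commute mult.commute)

lemma outer_quadratic_form: "d \<bullet> (outer v *v d) = (v \<bullet> d)\<^sup>2"
proof -
  have "outer v *v d = (v \<bullet> d) *\<^sub>R v"
    by (simp add: vec_eq_iff outer_def matrix_vector_mult_def inner_vec_def sum_distrib_left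
        sum_distrib_right mult_ac)
  then show ?thesis
    by (simp add: power2_eq_square inner_commute)
qed

lemma DT_app_D_app_quadratic_form:
  "d \<bullet> (matrix (\<lambda>v. DT_app l G x (D_app G x v)) *v d) = inprod l (D_app G x d) (D_app G x d)"
proof -
  have "linear (\<lambda>v. DT_app l G x (D_app G x v))"
    by (rule linearI) (simp_all add: DT_app_def D_app_def inner_add_right scaleR_add_left
        sum.distrib scaleR_sum_right)
  then show ?thesis
    by (simp add: matrix_works inner_DT_app)
qed

lemma sigma_quadratic_form:
  "d \<bullet> (sigma r m g xs x \<omega> *v d) =
     (\<Sum>i\<in>IB r m g xs. - (\<omega> i 0 / g i x 0) *
        inprod (m i) (D_app (g i) x d) (Gam (D_app (g i) x d)))"
proof -
  have lin: "linear (\<lambda>v. DT_app (m i) (g i) x (Gam (D_app (g i) x v)))" for i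
    by (rule linearI) (auto simp: DT_app_def D_app_def Gam_def inner_add_right scaleR_add_left
        scaleR_sum_right algebra_simps simp flip: sum.distrib intro!: sum.cong)
  show ?thesis
    by (simp add: sigma_def sum_matrix_vector_mult scaleR_matrix_vector_assoc[symmetric]
        matrix_works lin inner_sum_right inner_DT_app
        del: scaleR_minus_left)
qed

lemma tendsto_quadratic_form:
  fixes A :: "'b \<Rightarrow> real^'n^'n"
  assumes "(A \<longlongrightarrow> B) F" and "(d \<longlongrightarrow> e) F"
  shows "((\<lambda>k. d k \<bullet> (A k *v d k)) \<longlongrightarrow> e \<bullet> (B *v e)) F"
  unfolding matrix_vector_mult_def
  by (intro tendsto_intros tendsto_vec_lambda assms)

section \<open>The second-order cone\<close>

lemma tail_norm_nonneg [simp]: "0 \<le> tail_norm l w"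
  by (simp add: tail_norm_def L2_set_nonneg)

lemma tail_norm_square: "(tail_norm l w)\<^sup>2 = (\<Sum>j\<in>{1..<l}. (w j)\<^sup>2)"
  by (simp add: tail_norm_def L2_set_def sum_nonneg)

lemma tendsto_tail_norm:
  assumes "\<And>j. 0 < j \<Longrightarrow> j < l \<Longrightarrow> ((\<lambda>k. w k j) \<longlongrightarrow> v j) F"
  shows "((\<lambda>k. tail_norm l (w k)) \<longlongrightarrow> tail_norm l v) F"
  unfolding tail_norm_def L2_set_def using assms by (auto intro!: tendsto_intros)

lemma tail_norm_eq_0_iff: "tail_norm l w = 0 \<longleftrightarrow> (\<forall>j. 0 < j \<and> j < l \<longrightarrow> w j = 0)"
  by (auto simp: tail_norm_def L2_set_eq_0_iff)

lemma inprod_split: "0 < l \<Longrightarrow> inprod l v w = v 0 * w 0 + (\<Sum>j\<in>{1..<l}. v j * w j)"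
  by (simp add: inprod_def lessThan_atLeast0 sum.atLeast_Suc_lessThan)

lemma soc_limit:
  assumes "0 < l" and "F \<noteq> bot" and "\<And>k. w k \<in> soc l"
    and "\<And>j. j < l \<Longrightarrow> ((\<lambda>k. w k j) \<longlongrightarrow> v j) F"
  shows "v \<in> soc l"
  unfolding soc_def mem_Collect_eq
proof (rule tendsto_le[OF \<open>F \<noteq> bot\<close>])
  show "((\<lambda>k. w k 0) \<longlongrightarrow> v 0) F"
    using assms by simp
  show "((\<lambda>k. tail_norm l (w k)) \<longlongrightarrow> tail_norm l v) F"
    using assms by (intro tendsto_tail_norm) simp
  show "\<forall>\<^sub>F k in F. tail_norm l (w k) \<le> w k 0"
    using assms(3) by (simp add: soc_def)
qed

lemma soc_scale:
  assumes "0 \<le> c" and "w \<in> soc l"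
  shows "(\<lambda>j. c * w j) \<in> soc l"
proof -
  have "tail_norm l (\<lambda>j. c * w j) = c * tail_norm l w"
    using assms(1) by (simp add: tail_norm_def L2_set_right_distrib)
  then show ?thesis
    using assms by (simp add: soc_def mult_left_mono)
qed

text \<open>
  By the Cauchy--Schwarz inequality on the tails, the inner product is at least
  \<open>v\<^sub>0 w\<^sub>0\<close> minus the product of the two tail norms; as \<open>w\<close> is nonzero, the cone
  forces \<open>w\<^sub>0 > 0\<close>, and then \<open>v\<close> being interior makes the bound positive.
\<close>

lemma inprod_soc_int_pos:
  assumes "0 < l" "v \<in> soc_int l" "w \<in> soc l" and "\<exists>j<l. w j \<noteq> 0"
  shows "0 < inprod l v w"
proof -
  have vw: "tail_norm l v < v 0" "tail_norm l w \<le> w 0"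
    using assms by (auto simp: soc_int_def soc_def)
  have "w 0 \<noteq> 0"
  proof
    assume "w 0 = 0"
    moreover from this have "tail_norm l w = 0"
      using vw(2) tail_norm_nonneg[of l w] by linarith
    ultimately show False
      using assms(4) unfolding tail_norm_eq_0_iff by (metis gr0I)
  qed
  then have w0: "0 < w 0"
    using vw(2) tail_norm_nonneg[of l w] by linarith
  have "tail_norm l v * tail_norm l w \<le> tail_norm l v * w 0"
    using vw by (intro mult_left_mono) simp_all
  also have "\<dots> < v 0 * w 0"
    using vw w0 by simp
  finally have "tail_norm l v * tail_norm l w < v 0 * w 0" .
  moreover have "- (\<Sum>j\<in>{1..<l}. v j * w j) \<le> (\<Sum>j\<in>{1..<l}. \<bar>v j\<bar> * \<bar>w j\<bar>)"
    by (auto simp flip: sum_negf abs_mult intro!: sum_mono)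
  moreover have "(\<Sum>j\<in>{1..<l}. \<bar>v j\<bar> * \<bar>w j\<bar>) \<le> tail_norm l v * tail_norm l w"
    unfolding tail_norm_def by (rule L2_set_mult_ineq)
  ultimately show ?thesis
    by (simp add: inprod_split[OF \<open>0 < l\<close>])
qed

lemma feasible_cases:
  assumes "feasible p h r m g x" and "i < r" and "0 < m i"
  obtains "i \<in> I0 r m g x" | "i \<in> IB r m g x" | "i \<in> II r m g x"
proof -
  have "tail_norm (m i) (g i x) \<le> g i x 0"
    using assms by (auto simp: feasible_def soc_def)
  then consider "tail_norm (m i) (g i x) < g i x 0"
    | "g i x 0 = tail_norm (m i) (g i x)" "tail_norm (m i) (g i x) \<noteq> 0"
    | "g i x 0 = 0" "tail_norm (m i) (g i x) = 0"
    by fastforce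
  then show ?thesis
  proof cases
    case 1
    then show ?thesis
      using that(3) assms(2) by (simp add: II_def soc_int_def)
  next
    case 2
    then show ?thesis
      using that(2) assms(2) by (simp add: IB_def soc_bd_def)
  next
    case 3
    then have "g i x j = 0" if "j < m i" for j
      using that by (cases "j = 0") (auto simp: tail_norm_eq_0_iff)
    then show ?thesis
      using that(1) assms(2) by (simp add: I0_def)
  qed
qed

text \<open>
  Boundary multipliers whose normalised tails tend to \<open>- z\<close> normalised are, in the limit and
  up to a scalar, the reflection \<open>(z\<^sub>0, - z\<^sub>1, \<dots>)\<close> of the boundary point \<open>z\<close>, and this
  reflection is orthogonal to \<open>z\<close>.  The scaling \<open>t\<close> covers multipliers that are unbounded
  before they are normalised.
\<close>

lemma boundary_limit_complementary:
  fixes t :: "nat \<Rightarrow> real"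
  assumes l: "0 < l" and z: "z \<in> soc_bd l"
    and \<omega>: "\<And>k. \<omega> k \<in> soc_bd l"
    and dir: "\<And>j. 0 < j \<Longrightarrow> j < l \<Longrightarrow>
      (\<lambda>k. \<omega> k j / tail_norm l (\<omega> k)) \<longlonglongrightarrow> - (z j / tail_norm l z)"
    and lim: "\<And>j. j < l \<Longrightarrow> (\<lambda>k. t k * \<omega> k j) \<longlonglongrightarrow> w j"
  shows "inprod l z w = 0"
proof -
  have z0: "z 0 = tail_norm l z" "z 0 \<noteq> 0"
    using z by (auto simp: soc_bd_def)
  have wj: "w j = - (w 0 / z 0) * z j" if "0 < j" "j < l" for j
  proof -
    have "(\<lambda>k. (t k * \<omega> k 0) * (\<omega> k j / tail_norm l (\<omega> k))) \<longlonglongrightarrow>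
        w 0 * - (z j / tail_norm l z)"
      using that l by (intro tendsto_mult lim dir)
    moreover have "(t k * \<omega> k 0) * (\<omega> k j / tail_norm l (\<omega> k)) = t k * \<omega> k j" for k
      using \<omega>[of k] by (auto simp: soc_bd_def)
    ultimately have "(\<lambda>k. t k * \<omega> k j) \<longlonglongrightarrow> w 0 * - (z j / tail_norm l z)"
      by simp
    then have "w j = w 0 * - (z j / tail_norm l z)"
      using LIMSEQ_unique lim that(2) by blast
    then show ?thesis
      using z0 by simp
  qed
  have "(\<Sum>j\<in>{1..<l}. z j * w j) = (\<Sum>j\<in>{1..<l}. - (w 0 / z 0) * (z j)\<^sup>2)"
    by (rule sum.cong) (auto simp: wj power2_eq_square)
  also have "\<dots> = - (w 0 / z 0) * (z 0)\<^sup>2"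
    unfolding z0(1) tail_norm_square by (simp add: sum_distrib_left)
  also have "\<dots> = - (z 0 * w 0)"
    using z0(2) by (simp add: power2_eq_square)
  finally show ?thesis
    by (simp add: inprod_split[OF l])
qed

section \<open>Orthogonal complements under constant rank\<close>

text \<open>
  Linear independence persists under perturbation, with a uniform bound on the coefficients.
  At the limit, a left inverse of \<open>c \<mapsto> \<Sum> c\<^sub>b u\<^sub>b\<close>, built from linear functionals dual to the
  basis, gives such a bound with a constant \<open>K\<close>; perturbing each \<open>u\<^sub>b\<close> by at most
  \<open>1 / (2 K)\<close> costs half of it.
\<close>

lemma independent_uniform_bound:
  fixes u :: "'a \<Rightarrow> 'b::euclidean_space" and v :: "'c \<Rightarrow> 'a \<Rightarrow> 'b"
  assumes B: "finite B" "inj_on u B" "independent (u ` B)"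
    and lim: "\<And>b. b \<in> B \<Longrightarrow> ((\<lambda>k. v k b) \<longlongrightarrow> u b) F"
  obtains K where "0 < K"
    and "\<forall>\<^sub>F k in F. \<forall>c. (\<Sum>b\<in>B. \<bar>c b\<bar>) \<le> K * norm (\<Sum>b\<in>B. c b *\<^sub>R v k b)"
proof -
  have "\<exists>\<phi>. linear \<phi> \<and> (\<forall>x\<in>u ` B. \<phi> x = (if x = u b then 1 else (0::real)))" for b
    using linear_independent_extend[OF B(3), of "\<lambda>x. if x = u b then 1 else (0::real)"] by blast
  then obtain \<phi> where \<phi>: "\<And>b. linear (\<phi> b)"
    "\<And>b x. x \<in> u ` B \<Longrightarrow> \<phi> b x = (if x = u b then 1 else (0::real))"
    by metis
  have "\<exists>C>0. \<forall>x. norm (\<phi> b x) \<le> norm x * C" for b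
    using bounded_linear.pos_bounded \<phi>(1) linear_conv_bounded_linear by blast
  then obtain C where C: "\<And>b. 0 < C b" "\<And>b x. norm (\<phi> b x) \<le> norm x * C b"
    by metis
  define K where "K = 1 + (\<Sum>b\<in>B. C b)"
  have K: "0 < K"
    unfolding K_def by (intro add_pos_nonneg sum_nonneg) (auto simp: C(1) less_imp_le)
  have limit_bound: "(\<Sum>b\<in>B. \<bar>c b\<bar>) \<le> K * norm (\<Sum>b\<in>B. c b *\<^sub>R u b)" for c
  proof -
    let ?y = "\<Sum>b\<in>B. c b *\<^sub>R u b"
    have "\<bar>c b\<bar> \<le> norm ?y * C b" if "b \<in> B" for b
    proof -
      have "\<phi> b ?y = (\<Sum>a\<in>B. c a * \<phi> b (u a))"
        by (simp add: linear_sum[OF \<phi>(1)] linear_scale[OF \<phi>(1)])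
      also have "\<dots> = (\<Sum>a\<in>B. if a = b then c a else 0)"
        using B(2) that by (intro sum.cong) (auto simp: \<phi>(2) inj_on_def)
      also have "\<dots> = c b"
        using B(1) that by simp
      finally show ?thesis
        using C(2)[of b ?y] by simp
    qed
    then have "(\<Sum>b\<in>B. \<bar>c b\<bar>) \<le> (\<Sum>b\<in>B. norm ?y * C b)"
      by (rule sum_mono)
    also have "\<dots> \<le> K * norm ?y"
      by (simp add: K_def distrib_right flip: sum_distrib_left)
    finally show ?thesis .
  qed
  have "\<forall>\<^sub>F k in F. \<forall>b\<in>B. dist (v k b) (u b) < 1 / (2 * K)"
    using K lim by (intro eventually_ball_finite B(1) ballI tendstoD) auto
  then have "\<forall>\<^sub>F k in F. \<forall>c. (\<Sum>b\<in>B. \<bar>c b\<bar>) \<le> (2 * K) * norm (\<Sum>b\<in>B. c b *\<^sub>R v k b)"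
  proof (rule eventually_mono, intro allI)
    fix k c assume near: "\<forall>b\<in>B. dist (v k b) (u b) < 1 / (2 * K)"
    have "norm (\<Sum>b\<in>B. c b *\<^sub>R u b) - norm (\<Sum>b\<in>B. c b *\<^sub>R v k b)
        \<le> norm (\<Sum>b\<in>B. c b *\<^sub>R (u b - v k b))"
      by (simp add: scaleR_diff_right sum_subtractf norm_triangle_ineq2)
    also have "\<dots> \<le> (\<Sum>b\<in>B. \<bar>c b\<bar> * (1 / (2 * K)))"
    proof (rule sum_norm_le)
      fix b assume "b \<in> B"
      then have "norm (u b - v k b) \<le> 1 / (2 * K)"
        using near by (auto simp: dist_norm norm_minus_commute less_imp_le)
      then show "norm (c b *\<^sub>R (u b - v k b)) \<le> \<bar>c b\<bar> * (1 / (2 * K))"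
        by (simp only: norm_scaleR) (rule mult_left_mono, auto)
    qed
    finally have "K * norm (\<Sum>b\<in>B. c b *\<^sub>R u b) \<le>
        K * (norm (\<Sum>b\<in>B. c b *\<^sub>R v k b) + (\<Sum>b\<in>B. \<bar>c b\<bar>) * (1 / (2 * K)))"
      using K by (intro mult_left_mono) (simp_all add: sum_divide_distrib)
    also have "\<dots> = K * norm (\<Sum>b\<in>B. c b *\<^sub>R v k b) + (\<Sum>b\<in>B. \<bar>c b\<bar>) / 2"
      using K by (simp add: field_simps)
    finally show "(\<Sum>b\<in>B. \<bar>c b\<bar>) \<le> (2 * K) * norm (\<Sum>b\<in>B. c b *\<^sub>R v k b)"
      using limit_bound[of c] by linarith
  qed
  with K show ?thesis
    by (intro that[of "2 * K"]) auto
qed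

text \<open>
  Take for \<open>D k\<close> the projection of \<open>d\<close> onto the orthogonal complement of the \<open>v k a\<close>, and let
  \<open>y = d - D k\<close>.  As the rank does not exceed that of the limit, \<open>y\<close> is a combination
  of those \<open>v k b\<close> whose limits form a basis, with coefficients bounded by a multiple of
  \<open>norm y\<close>.  Hence \<open>(norm y)\<^sup>2 = y \<bullet> d\<close> is at most a multiple of \<open>norm y\<close> times
  \<open>\<Sum> \<bar>v k b \<bullet> d\<bar>\<close>, and this sum tends to \<open>0\<close>.
\<close>

lemma orthogonal_approximation:
  fixes u :: "'a \<Rightarrow> 'b::euclidean_space" and v :: "'c \<Rightarrow> 'a \<Rightarrow> 'b"
  assumes A: "finite A"
    and lim: "\<And>a. a \<in> A \<Longrightarrow> ((\<lambda>k. v k a) \<longlongrightarrow> u a) F"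
    and rank: "\<forall>\<^sub>F k in F. dim (v k ` A) \<le> dim (u ` A)"
    and d: "\<And>a. a \<in> A \<Longrightarrow> u a \<bullet> d = 0"
  obtains D where "(D \<longlongrightarrow> d) F" and "\<And>k a. a \<in> A \<Longrightarrow> v k a \<bullet> D k = 0"
proof -
  obtain S where S: "S \<subseteq> u ` A" "independent S" "card S = dim (u ` A)"
    by (rule basis_exists)
  then obtain B where B: "B \<subseteq> A" "inj_on u B" "S = u ` B"
    by (auto simp: subset_image_inj)
  have finB: "finite B"
    using A B(1) finite_subset by blast
  have cardB: "card B = dim (u ` A)"
    using S(3) B by (simp add: card_image)
  obtain K where K: "0 < K"
    "\<forall>\<^sub>F k in F. \<forall>c. (\<Sum>b\<in>B. \<bar>c b\<bar>) \<le> K * norm (\<Sum>b\<in>B. c b *\<^sub>R v k b)"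
  proof (rule independent_uniform_bound[OF finB B(2)])
    show "independent (u ` B)"
      using S(2) B(3) by simp
    show "((\<lambda>k. v k b) \<longlongrightarrow> u b) F" if "b \<in> B" for b
      using lim that B(1) by blast
  qed
  have "\<forall>k. \<exists>y z. y \<in> span (v k ` A) \<and> (\<forall>w \<in> span (v k ` A). orthogonal z w) \<and> d = y + z"
    by (rule allI, rule orthogonal_subspace_decomp_exists[of "v _ ` A" d]) blast
  from this[unfolded choice_iff] obtain Y D where YD: "\<And>k. Y k \<in> span (v k ` A)"
    "\<And>k w. w \<in> span (v k ` A) \<Longrightarrow> orthogonal (D k) w" "\<And>k. d = Y k + D k"
    by blast
  have "\<forall>\<^sub>F k in F. norm (Y k) \<le> K * (\<Sum>b\<in>B. \<bar>v k b \<bullet> d\<bar>)"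
    using K(2) rank
  proof eventually_elim
    case (elim k)
    note bound = elim(1)[rule_format]
    have inj: "inj_on (v k) B"
    proof (rule inj_onI, rule ccontr)
      fix a b assume ab: "a \<in> B" "b \<in> B" "v k a = v k b" "a \<noteq> b"
      let ?c = "\<lambda>x. (if x = a then 1 else 0) - (if x = b then 1 else (0::real))"
      have "(\<Sum>x\<in>B. ?c x *\<^sub>R v k x) =
          (\<Sum>x\<in>B. (if x = a then v k a else 0) - (if x = b then v k b else 0))"
        by (rule sum.cong) auto
      also have "\<dots> = v k a - v k b"
        using ab(1,2) finB by (simp add: sum_subtractf)
      finally have "(\<Sum>x\<in>B. ?c x *\<^sub>R v k x) = v k a - v k b" .
      then have "(\<Sum>x\<in>B. \<bar>?c x\<bar>) \<le> 0"
        using bound[of ?c] ab by simp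
      moreover have "\<bar>?c a\<bar> \<le> (\<Sum>x\<in>B. \<bar>?c x\<bar>)"
        using ab finB by (intro member_le_sum) auto
      ultimately show False
        using ab by simp
    qed
    have "independent (v k ` B)"
    proof
      assume "dependent (v k ` B)"
      then obtain c w where c: "w \<in> v k ` B" "c w \<noteq> 0" "(\<Sum>x\<in>v k ` B. c x *\<^sub>R x) = 0"
        using finB by (auto simp: dependent_finite)
      then obtain b where b: "b \<in> B" "c (v k b) \<noteq> 0"
        by auto
      have "(\<Sum>x\<in>B. \<bar>c (v k x)\<bar>) \<le> 0"
        using bound[of "\<lambda>x. c (v k x)"] c(3) by (simp add: sum.reindex[OF inj])
      moreover have "\<bar>c (v k b)\<bar> \<le> (\<Sum>x\<in>B. \<bar>c (v k x)\<bar>)"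
        using b finB by (intro member_le_sum) auto
      ultimately show False
        using b by simp
    qed
    moreover have "v k ` B \<subseteq> v k ` A"
      using B(1) by blast
    moreover have "dim (v k ` A) \<le> card (v k ` B)"
      using elim(2) cardB inj by (simp add: card_image)
    ultimately have "v k ` A \<subseteq> span (v k ` B)"
      using card_ge_dim_independent by blast
    then have "Y k \<in> span (v k ` B)"
      using YD(1)[of k] span_mono span_span by blast
    then obtain c' where "Y k = (\<Sum>x\<in>v k ` B. c' x *\<^sub>R x)"
      using finB by (auto simp: span_finite)
    then obtain c where c: "Y k = (\<Sum>b\<in>B. c b *\<^sub>R v k b)"
      using sum.reindex[OF inj, of "\<lambda>x. c' x *\<^sub>R x"] by (auto simp: o_def)
    have "(norm (Y k))\<^sup>2 = Y k \<bullet> d"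
      using YD(2)[OF YD(1)[of k]] YD(3)[of k]
      by (simp add: orthogonal_def inner_add_right inner_commute flip: power2_norm_eq_inner)
    also have "\<dots> = (\<Sum>b\<in>B. c b * (v k b \<bullet> d))"
      by (simp add: c inner_sum_left)
    also have "\<dots> \<le> (\<Sum>b\<in>B. \<bar>c b\<bar> * (\<Sum>b\<in>B. \<bar>v k b \<bullet> d\<bar>))"
    proof (rule sum_mono)
      fix b assume "b \<in> B"
      then have "\<bar>v k b \<bullet> d\<bar> \<le> (\<Sum>b\<in>B. \<bar>v k b \<bullet> d\<bar>)"
        using finB by (intro member_le_sum) auto
      then have "\<bar>c b\<bar> * \<bar>v k b \<bullet> d\<bar> \<le> \<bar>c b\<bar> * (\<Sum>b\<in>B. \<bar>v k b \<bullet> d\<bar>)"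
        by (rule mult_left_mono) simp
      then show "c b * (v k b \<bullet> d) \<le> \<bar>c b\<bar> * (\<Sum>b\<in>B. \<bar>v k b \<bullet> d\<bar>)"
        by (metis abs_ge_self abs_mult order_trans)
    qed
    also have "\<dots> \<le> (K * norm (Y k)) * (\<Sum>b\<in>B. \<bar>v k b \<bullet> d\<bar>)"
      using bound[of c] by (simp add: c mult_right_mono sum_nonneg flip: sum_distrib_right)
    finally have "norm (Y k) * norm (Y k) \<le> norm (Y k) * (K * (\<Sum>b\<in>B. \<bar>v k b \<bullet> d\<bar>))"
      by (simp add: power2_eq_square mult_ac)
    then show ?case
    proof (cases "norm (Y k) = 0")
      case True
      then show ?thesis
        using K(1) by (simp add: sum_nonneg)
    next
      case False
      then have "0 < norm (Y k)"
        by simp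
      then show ?thesis
        using \<open>norm (Y k) * norm (Y k) \<le> _\<close> mult_le_cancel_left_pos by blast
    qed
  qed
  moreover have "((\<lambda>k. K * (\<Sum>b\<in>B. \<bar>v k b \<bullet> d\<bar>)) \<longlongrightarrow> K * (\<Sum>b\<in>B. \<bar>u b \<bullet> d\<bar>)) F"
    using B(1) lim by (intro tendsto_intros) auto
  moreover have "K * (\<Sum>b\<in>B. \<bar>u b \<bullet> d\<bar>) = 0"
    using B(1) d by (simp add: subset_iff)
  ultimately have "(Y \<longlongrightarrow> 0) F"
    by (intro Lim_null_comparison[where f = Y]) simp_all
  then have "((\<lambda>k. d - Y k) \<longlongrightarrow> d - 0) F"
    by (intro tendsto_intros)
  moreover have "(\<lambda>k. d - Y k) = D"
  proof (rule ext)
    show "d - Y k = D k" for k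
      using YD(3)[of k] by simp
  qed
  ultimately have "(D \<longlongrightarrow> d) F"
    by simp
  moreover have "v k a \<bullet> D k = 0" if "a \<in> A" for k a
    using YD(2)[of "v k a" k] that by (simp add: span_base orthogonal_def inner_commute)
  ultimately show ?thesis
    using that by blast
qed

section \<open>Bounded multipliers\<close>

lemma DT_app_scale: "DT_app l G x (\<lambda>j. c * w j) = c *\<^sub>R DT_app l G x w"
  by (simp add: DT_app_def scaleR_sum_right)

lemma tendsto_DT_app:
  assumes "\<forall>j<l. twice_cont_diff (\<lambda>x. G x j)" and "(X \<longlongrightarrow> x) F"
    and "\<And>j. j < l \<Longrightarrow> ((\<lambda>k. w k j) \<longlongrightarrow> v j) F"
  shows "((\<lambda>k. DT_app l G (X k) (w k)) \<longlongrightarrow> DT_app l G x v) F"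
  unfolding DT_app_def
  using assms by (intro tendsto_sum tendsto_scaleR twice_cont_diff_tendsto(2)[OF _ assms(2)]) auto

lemma tendsto_D_app:
  assumes "twice_cont_diff (\<lambda>x. G x j)" and "(X \<longlongrightarrow> x) F" and "(d \<longlongrightarrow> e) F"
  shows "((\<lambda>k. D_app G (X k) (d k) j) \<longlongrightarrow> D_app G x e j) F"
  unfolding D_app_def
  using assms by (intro tendsto_inner twice_cont_diff_tendsto(2)[OF _ assms(2)]) auto

lemma common_convergent_subsequence:
  fixes S :: "(nat \<Rightarrow> real) set"
  assumes "finite S" and "\<And>s. s \<in> S \<Longrightarrow> Bseq s"
  shows "\<exists>\<phi>::nat \<Rightarrow> nat. strict_mono \<phi> \<and> (\<forall>s\<in>S. convergent (s \<circ> \<phi>))"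
  using assms
proof (induction S rule: finite_induct)
  case empty
  show ?case
    using strict_mono_id by blast
next
  case (insert s S)
  then obtain \<phi> :: "nat \<Rightarrow> nat"
    where \<phi>: "strict_mono \<phi>" "\<forall>s\<in>S. convergent (s \<circ> \<phi>)"
    by blast
  have "Bseq (s \<circ> \<phi>)"
    using insert.prems[of s] by (auto simp: o_def intro: Bseq_subseq)
  then have "bounded (range (s \<circ> \<phi>))"
    by (simp add: Bseq_eq_bounded)
  then obtain \<psi> :: "nat \<Rightarrow> nat" and l where \<psi>: "strict_mono \<psi>" "((s \<circ> \<phi>) \<circ> \<psi>) \<longlonglongrightarrow> l"
    using bounded_imp_convergent_subsequence[of "s \<circ> \<phi>"] by metis
  have "convergent (s' \<circ> (\<phi> \<circ> \<psi>))" if "s' \<in> insert s S" for s'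
  proof (cases "s' = s")
    case True
    then show ?thesis
      using \<psi>(2) unfolding convergent_def o_assoc by blast
  next
    case False
    then have "convergent (s' \<circ> \<phi>)"
      using \<phi>(2) that by blast
    then show ?thesis
      using convergent_subseq_convergent[OF _ \<psi>(1), of "s' \<circ> \<phi>"] by (simp add: o_assoc)
  qed
  moreover have "strict_mono (\<phi> \<circ> \<psi>)"
    using \<phi>(1) \<psi>(1) by (rule strict_mono_o)
  ultimately show ?case
    by blast
qed

lemma independent_of_dim_eq:
  fixes G :: "nat \<Rightarrow> 'b::euclidean_space"
  assumes dim: "dim (G ` {..<p}) = p" and zero: "(\<Sum>i<p. c i *\<^sub>R G i) = 0" and "i < p"
  shows "c i = 0"
proof -
  have "card (G ` {..<p}) \<le> p"
    using card_image_le[of "{..<p}" G] by simp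
  moreover have "p \<le> card (G ` {..<p})"
    using dim_le_card[of "G ` {..<p}" "G ` {..<p}"] dim by (simp add: span_superset)
  ultimately have card: "card (G ` {..<p}) = p"
    by simp
  then have inj: "inj_on G {..<p}"
    by (intro eq_card_imp_inj_on) simp_all
  obtain B where B: "B \<subseteq> G ` {..<p}" "independent B" "card B = dim (G ` {..<p})"
    by (rule basis_exists)
  then have "B = G ` {..<p}"
    using card dim by (intro card_subset_eq) simp_all
  with B have ind: "independent (G ` {..<p})"
    by simp
  let ?c = "\<lambda>x. c (the_inv_into {..<p} G x)"
  have "(\<Sum>x\<in>G ` {..<p}. ?c x *\<^sub>R x) = 0"
    using zero by (simp add: sum.reindex[OF inj] the_inv_into_f_f[OF inj])
  then have "?c (G i) = 0"
    using independentD[OF ind finite_imageI[OF finite_lessThan] subset_refl, of ?c] \<open>i < p\<close> by blast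
  then show ?thesis
    using \<open>i < p\<close> by (simp add: the_inv_into_f_f[OF inj])
qed

text \<open>
  Robinson's constraint qualification excludes abnormal multipliers.  Pairing the stationarity
  equation with the Robinson direction \<open>d\<close> and adding complementarity shows that the products
  of the \<open>w\<^sub>i\<close> with the interior points \<open>g\<^sub>i + Dg\<^sub>i d\<close> sum to zero; each product is positive
  unless \<open>w\<^sub>i = 0\<close>.  The full rank of \<open>Dh\<close> then disposes of \<open>u\<close>.
\<close>

lemma robinson_no_abnormal_multiplier:
  assumes m: "\<forall>i<r. m i \<ge> 1" and cq: "robinson_cq p h r m g x"
    and w: "\<forall>i<r. w i \<in> soc (m i)" "\<forall>i<r. inprod (m i) (g i x) (w i) = 0"
    and stat: "(\<Sum>i<p. u i *\<^sub>R grad (\<lambda>y. h y i) x) - (\<Sum>i<r. DT_app (m i) (g i) x (w i)) = 0"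
  shows "\<forall>i<p. u i = 0" and "\<forall>i<r. \<forall>j<m i. w i j = 0"
proof -
  obtain d where d: "\<forall>i<r. (\<lambda>j. g i x j + D_app (g i) x d j) \<in> soc_int (m i)"
    "\<forall>i<p. D_app h x d i = 0"
    and dim: "dim ((\<lambda>i. grad (\<lambda>y. h y i) x) ` {..<p}) = p"
    using cq by (auto simp: robinson_cq_def)
  let ?z = "\<lambda>i. inprod (m i) (\<lambda>j. g i x j + D_app (g i) x d j) (w i)"
  have pos: "0 < ?z i" if "i < r" "\<exists>j<m i. w i j \<noteq> 0" for i
    using m d(1) w(1) that by (intro inprod_soc_int_pos) auto
  have zero: "?z i = 0" if "i < r" "\<not> (\<exists>j<m i. w i j \<noteq> 0)" for i
    using that by (simp add: inprod_def)
  have "d \<bullet> (\<Sum>i<p. u i *\<^sub>R grad (\<lambda>y. h y i) x) = 0"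
    using d(2) by (simp add: D_app_def inner_sum_right inner_commute)
  moreover have "d \<bullet> ((\<Sum>i<p. u i *\<^sub>R grad (\<lambda>y. h y i) x)
      - (\<Sum>i<r. DT_app (m i) (g i) x (w i))) = 0"
    by (simp only: stat inner_zero_right)
  ultimately have "(\<Sum>i<r. inprod (m i) (D_app (g i) x d) (w i)) = 0"
    by (simp add: inner_diff_right inner_sum_right inner_DT_app)
  moreover have "(\<Sum>i<r. ?z i) = (\<Sum>i<r. inprod (m i) (g i x) (w i))
      + (\<Sum>i<r. inprod (m i) (D_app (g i) x d) (w i))"
    by (simp add: inprod_def distrib_right sum.distrib)
  ultimately have "(\<Sum>i<r. ?z i) = 0"
    using w(2) by simp
  moreover have "0 \<le> ?z i" if "i < r" for i
    using pos[OF that] zero[OF that] by (cases "\<exists>j<m i. w i j \<noteq> 0") auto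
  ultimately have "\<forall>i<r. ?z i = 0"
    by (subst (asm) sum_nonneg_eq_0_iff) auto
  then show w0: "\<forall>i<r. \<forall>j<m i. w i j = 0"
    using pos by (metis less_irrefl)
  then have "(\<Sum>i<p. u i *\<^sub>R grad (\<lambda>y. h y i) x) = 0"
    using stat by (simp add: DT_app_def)
  then show "\<forall>i<p. u i = 0"
    using independent_of_dim_eq[OF dim] by blast
qed

lemma AKKT_seq_subseq:
  assumes "AKKT_seq f p h r m g xs X \<mu> \<omega>" and "strict_mono \<phi>"
  shows "AKKT_seq f p h r m g xs (\<lambda>k. X (\<phi> k)) (\<lambda>k. \<mu> (\<phi> k)) (\<lambda>k. \<omega> (\<phi> k))"
proof -
  have sub: "(\<lambda>k. s (\<phi> k)) \<longlonglongrightarrow> l" if "s \<longlonglongrightarrow> l" for s :: "nat \<Rightarrow> 'c::topological_space" and l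
    using LIMSEQ_subseq_LIMSEQ[OF that assms(2)] by (simp add: o_def)
  show ?thesis
    using assms(1) unfolding AKKT_seq_def by (fast intro: sub)
qed

lemma AKKT_limit_complementary:
  assumes m: "0 < m i" "i < r" and akkt: "AKKT_seq f p h r m g xs X \<mu> \<omega>"
    and t: "t \<longlonglongrightarrow> \<tau>"
    and lim: "\<And>j. j < m i \<Longrightarrow> (\<lambda>k. t k * \<omega> k i j) \<longlonglongrightarrow> w j"
  shows "inprod (m i) (g i xs) w = 0"
proof -
  have vanish: "inprod (m i) (g i xs) w = 0" if "\<forall>j<m i. (\<lambda>k. \<omega> k i j) \<longlonglongrightarrow> 0"
  proof -
    have "w j = 0" if "j < m i" for j
    proof -
      have "(\<lambda>k. t k * \<omega> k i j) \<longlonglongrightarrow> \<tau> * 0"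
        using \<open>\<forall>j<m i. _\<close> that t by (intro tendsto_mult) auto
      then show ?thesis
        using LIMSEQ_unique[OF lim[OF that]] by simp
    qed
    then show ?thesis
      by (simp add: inprod_def)
  qed
  have "feasible p h r m g xs"
    using akkt by (simp add: AKKT_seq_def)
  then consider "i \<in> I0 r m g xs" | "i \<in> IB r m g xs" | "i \<in> II r m g xs"
    using m feasible_cases by metis
  then show ?thesis
  proof cases
    case 1
    then show ?thesis
      by (simp add: I0_def inprod_def)
  next
    case 2
    then consider "\<forall>j<m i. (\<lambda>k. \<omega> k i j) \<longlonglongrightarrow> 0"
      | "\<forall>k. \<omega> k i \<in> soc_bd (m i)" "\<forall>j\<in>{1..<m i}. (\<lambda>k. \<omega> k i j / tail_norm (m i) (\<omega> k i))
            \<longlonglongrightarrow> - (g i xs j / tail_norm (m i) (g i xs))"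
      using akkt unfolding AKKT_seq_def by blast
    then show ?thesis
    proof cases
      case 1
      then show ?thesis
        by (rule vanish)
    next
      case 2
      with \<open>i \<in> IB r m g xs\<close> m(1) show ?thesis
        by (intro boundary_limit_complementary[where t = t and \<omega> = "\<lambda>k. \<omega> k i"] lim)
          (auto simp: IB_def)
    qed
  next
    case 3
    then show ?thesis
      using akkt by (intro vanish) (auto simp: AKKT_seq_def)
  qed
qed

text \<open>
  Normalising all multipliers, including the coefficient \<open>t\<close> of the objective, to total mass
  one allows one compactness argument to produce a nontrivial Fritz John limit
  \<open>(\<tau>, u, w)\<close>.  If \<open>\<tau> = 0\<close> this limit would be an abnormal multiplier, so \<open>\<tau> > 0\<close>, and
  dividing by \<open>t\<close> shows that the multipliers themselves converge along the subsequence.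
\<close>

theorem AKKT_robinson_imp_KKT:
  assumes m: "\<forall>i<r. m i \<ge> 1"
    and f: "twice_cont_diff f" and h: "\<forall>i<p. twice_cont_diff (\<lambda>x. h x i)"
    and g: "\<forall>i<r. \<forall>j<m i. twice_cont_diff (\<lambda>x. g i x j)"
    and akkt: "AKKT_seq f p h r m g xs X \<mu> \<omega>"
    and cq: "robinson_cq p h r m g xs"
  obtains \<phi> \<mu>' \<omega>' where "strict_mono \<phi>" and "KKT_triple f p h r m g xs \<mu>' \<omega>'"
    and "\<And>i. i < p \<Longrightarrow> (\<lambda>k. \<mu> (\<phi> k) i) \<longlonglongrightarrow> \<mu>' i"
    and "\<And>i j. i < r \<Longrightarrow> j < m i \<Longrightarrow> (\<lambda>k. \<omega> (\<phi> k) i j) \<longlonglongrightarrow> \<omega>' i j"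
proof -
  define M where "M k = (\<Sum>i<p. \<bar>\<mu> k i\<bar>) + (\<Sum>i<r. \<Sum>j<m i. \<bar>\<omega> k i j\<bar>)" for k
  define t where "t k = 1 / (1 + M k)" for k
  define U where "U i k = t k * \<mu> k i" for i k
  define W where "W i j k = t k * \<omega> k i j" for i j k
  have M0: "0 \<le> M k" for k
    by (simp add: M_def sum_nonneg)
  then have t0: "0 < t k" for k
    by (simp add: t_def add_pos_nonneg)
  have total: "t k + (\<Sum>i<p. \<bar>U i k\<bar>) + (\<Sum>i<r. \<Sum>j<m i. \<bar>W i j k\<bar>) = 1" for k
  proof -
    have "t k + (\<Sum>i<p. \<bar>U i k\<bar>) + (\<Sum>i<r. \<Sum>j<m i. \<bar>W i j k\<bar>) = t k * (1 + M k)"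
      using t0[of k]
      by (simp add: U_def W_def M_def abs_mult distrib_left sum_distrib_left)
    also have "\<dots> = 1"
      using M0[of k] by (simp add: t_def)
    finally show ?thesis .
  qed
  have bound: "t k \<le> 1" "i < p \<Longrightarrow> \<bar>U i k\<bar> \<le> 1"
    "i < r \<Longrightarrow> j < m i \<Longrightarrow> \<bar>W i j k\<bar> \<le> 1" for i j k
  proof -
    have U: "\<bar>U i k\<bar> \<le> (\<Sum>i<p. \<bar>U i k\<bar>)" if "i < p"
      using that by (intro member_le_sum) auto
    have W: "\<bar>W i j k\<bar> \<le> (\<Sum>i<r. \<Sum>j<m i. \<bar>W i j k\<bar>)" if "i < r" "j < m i"
    proof -
      have "\<bar>W i j k\<bar> \<le> (\<Sum>j<m i. \<bar>W i j k\<bar>)"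
        using that by (intro member_le_sum) auto
      also have "\<dots> \<le> (\<Sum>i<r. \<Sum>j<m i. \<bar>W i j k\<bar>)"
        using that by (intro member_le_sum[where f = "\<lambda>i. \<Sum>j<m i. \<bar>W i j k\<bar>"])
          (auto intro: sum_nonneg)
      finally show ?thesis .
    qed
    have "0 \<le> (\<Sum>i<p. \<bar>U i k\<bar>)" "0 \<le> (\<Sum>i<r. \<Sum>j<m i. \<bar>W i j k\<bar>)"
      by (simp_all add: sum_nonneg)
    then have "t k \<le> 1" "(\<Sum>i<p. \<bar>U i k\<bar>) \<le> 1" "(\<Sum>i<r. \<Sum>j<m i. \<bar>W i j k\<bar>) \<le> 1"
      using total[of k] t0[of k] by linarith+
    then show "t k \<le> 1" "i < p \<Longrightarrow> \<bar>U i k\<bar> \<le> 1" "i < r \<Longrightarrow> j < m i \<Longrightarrow> \<bar>W i j k\<bar> \<le> 1"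
      using U W order_trans by blast+
  qed
  let ?S = "insert t (U ` {..<p} \<union> (\<lambda>(i, j). W i j) ` (SIGMA i:{..<r}. {..<m i}))"
  have "\<exists>\<phi>::nat \<Rightarrow> nat. strict_mono \<phi> \<and> (\<forall>s\<in>?S. convergent (s \<circ> \<phi>))"
  proof (rule common_convergent_subsequence)
    have "\<bar>t k\<bar> \<le> 1" for k
      using bound(1) t0 by (simp add: less_imp_le)
    then show "Bseq s" if "s \<in> ?S" for s
      using that bound by (intro BseqI'[of _ 1]) auto
  qed simp
  then obtain \<phi> :: "nat \<Rightarrow> nat" where \<phi>: "strict_mono \<phi>" "\<forall>s\<in>?S. convergent (s \<circ> \<phi>)"
    by blast
  define \<tau> where "\<tau> = lim (t \<circ> \<phi>)"
  define u where "u i = lim (U i \<circ> \<phi>)" for i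
  define w where "w i j = lim (W i j \<circ> \<phi>)" for i j
  have t_lim: "(\<lambda>k. t (\<phi> k)) \<longlonglongrightarrow> \<tau>"
    using \<phi>(2) unfolding \<tau>_def by (simp add: convergent_LIMSEQ_iff o_def)
  have U_lim: "(\<lambda>k. U i (\<phi> k)) \<longlonglongrightarrow> u i" if "i < p" for i
    using \<phi>(2) that unfolding u_def by (auto simp: convergent_LIMSEQ_iff o_def)
  have W_lim: "(\<lambda>k. W i j (\<phi> k)) \<longlonglongrightarrow> w i j" if "i < r" "j < m i" for i j
  proof -
    have "W i j \<in> ?S"
      using that by force
    then show ?thesis
      using \<phi>(2) unfolding w_def by (auto simp: convergent_LIMSEQ_iff o_def)
  qed
  note akkt' = AKKT_seq_subseq[OF akkt \<phi>(1)]
  have X_lim: "(\<lambda>k. X (\<phi> k)) \<longlonglongrightarrow> xs" and feas: "feasible p h r m g xs"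
    using akkt' by (auto simp: AKKT_seq_def)
  have mass: "\<tau> + (\<Sum>i<p. \<bar>u i\<bar>) + (\<Sum>i<r. \<Sum>j<m i. \<bar>w i j\<bar>) = 1"
  proof (rule LIMSEQ_unique)
    show "(\<lambda>k. t (\<phi> k) + (\<Sum>i<p. \<bar>U i (\<phi> k)\<bar>) + (\<Sum>i<r. \<Sum>j<m i. \<bar>W i j (\<phi> k)\<bar>))
        \<longlonglongrightarrow> \<tau> + (\<Sum>i<p. \<bar>u i\<bar>) + (\<Sum>i<r. \<Sum>j<m i. \<bar>w i j\<bar>)"
      using t_lim U_lim W_lim by (intro tendsto_intros) auto
    show "(\<lambda>k. t (\<phi> k) + (\<Sum>i<p. \<bar>U i (\<phi> k)\<bar>) + (\<Sum>i<r. \<Sum>j<m i. \<bar>W i j (\<phi> k)\<bar>)) \<longlonglongrightarrow> 1"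
      by (simp add: total)
  qed
  have \<omega>_soc: "\<omega> (\<phi> k) i \<in> soc (m i)" if "i < r" for i k
    using akkt' that by (auto simp: AKKT_seq_def)
  have w_soc: "w i \<in> soc (m i)" if "i < r" for i
  proof (rule soc_limit[where F = sequentially and w = "\<lambda>k j. W i j (\<phi> k)"])
    show "(\<lambda>j. W i j (\<phi> k)) \<in> soc (m i)" for k
      using soc_scale[OF less_imp_le[OF t0] \<omega>_soc[OF that]] by (simp add: W_def)
  qed (use m that W_lim in auto)
  have w_compl: "inprod (m i) (g i xs) (w i) = 0" if "i < r" for i
  proof (rule AKKT_limit_complementary[OF _ that akkt' t_lim])
    show "0 < m i"
      using m that by auto
    show "(\<lambda>k. t (\<phi> k) * \<omega> (\<phi> k) i j) \<longlonglongrightarrow> w i j" if "j < m i" for j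
      using W_lim[OF \<open>i < r\<close> that] by (simp add: W_def)
  qed
  have stat: "\<tau> *\<^sub>R grad f xs + (\<Sum>i<p. u i *\<^sub>R grad (\<lambda>y. h y i) xs)
      - (\<Sum>i<r. DT_app (m i) (g i) xs (w i)) = 0"
  proof (rule LIMSEQ_unique)
    let ?L = "\<lambda>k. t (\<phi> k) *\<^sub>R grad f (X (\<phi> k)) + (\<Sum>i<p. U i (\<phi> k) *\<^sub>R grad (\<lambda>y. h y i) (X (\<phi> k)))
        - (\<Sum>i<r. DT_app (m i) (g i) (X (\<phi> k)) (\<lambda>j. W i j (\<phi> k)))"
    show "?L \<longlonglongrightarrow> \<tau> *\<^sub>R grad f xs + (\<Sum>i<p. u i *\<^sub>R grad (\<lambda>y. h y i) xs)
        - (\<Sum>i<r. DT_app (m i) (g i) xs (w i))"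
      using f h g t_lim U_lim W_lim X_lim
      by (intro tendsto_diff tendsto_add tendsto_sum tendsto_scaleR tendsto_DT_app
          twice_cont_diff_tendsto(2)[OF _ X_lim]) auto
    have "?L k = t (\<phi> k) *\<^sub>R grad_L f p h r m g (X (\<phi> k)) (\<mu> (\<phi> k)) (\<omega> (\<phi> k))" for k
      by (simp add: grad_L_def grad_lagrangian[OF f h g] U_def W_def DT_app_scale
          scaleR_add_right scaleR_diff_right scaleR_sum_right)
    moreover have "(\<lambda>k. t (\<phi> k) *\<^sub>R grad_L f p h r m g (X (\<phi> k)) (\<mu> (\<phi> k)) (\<omega> (\<phi> k)))
        \<longlonglongrightarrow> \<tau> *\<^sub>R 0"
      using akkt' by (intro tendsto_scaleR t_lim) (simp add: AKKT_seq_def)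
    ultimately show "?L \<longlonglongrightarrow> 0"
      by simp
  qed
  have "\<tau> \<noteq> 0"
  proof
    assume "\<tau> = 0"
    then have "(\<Sum>i<p. u i *\<^sub>R grad (\<lambda>y. h y i) xs) - (\<Sum>i<r. DT_app (m i) (g i) xs (w i)) = 0"
      using stat by simp
    then have "\<forall>i<p. u i = 0" "\<forall>i<r. \<forall>j<m i. w i j = 0"
      using robinson_no_abnormal_multiplier[OF m cq, of w u] w_soc w_compl by auto
    then show False
      using mass \<open>\<tau> = 0\<close> by simp
  qed
  moreover have "0 \<le> \<tau>"
    using t0 by (intro LIMSEQ_le_const[OF t_lim]) (auto intro: less_imp_le)
  ultimately have \<tau>0: "0 < \<tau>"
    by simp
  define \<mu>' where "\<mu>' i = (1 / \<tau>) * u i" for i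
  define \<omega>' where "\<omega>' i j = (1 / \<tau>) * w i j" for i j
  have "(\<lambda>k. \<mu> (\<phi> k) i) \<longlonglongrightarrow> \<mu>' i" if "i < p" for i
  proof -
    have "(\<lambda>k. U i (\<phi> k) / t (\<phi> k)) \<longlonglongrightarrow> u i / \<tau>"
      using \<tau>0 by (intro tendsto_divide U_lim t_lim that) simp
    then show ?thesis
      using t0 by (simp add: U_def \<mu>'_def less_imp_neq[THEN not_sym])
  qed
  moreover have "(\<lambda>k. \<omega> (\<phi> k) i j) \<longlonglongrightarrow> \<omega>' i j" if "i < r" "j < m i" for i j
  proof -
    have "(\<lambda>k. W i j (\<phi> k) / t (\<phi> k)) \<longlonglongrightarrow> w i j / \<tau>"
      using \<tau>0 by (intro tendsto_divide W_lim t_lim that) simp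
    then show ?thesis
      using t0 by (simp add: W_def \<omega>'_def less_imp_neq[THEN not_sym])
  qed
  moreover have "KKT_triple f p h r m g xs \<mu>' \<omega>'"
    unfolding KKT_triple_def
  proof (intro conjI allI impI)
    show "\<omega>' i \<in> soc (m i)" if "i < r" for i
      using soc_scale[OF _ w_soc[OF that], of "1 / \<tau>"] \<tau>0 by (simp add: \<omega>'_def[abs_def])
    show "inprod (m i) (g i xs) (\<omega>' i) = 0" if "i < r" for i
    proof -
      have "inprod (m i) (g i xs) (\<omega>' i) = (1 / \<tau>) * inprod (m i) (g i xs) (w i)"
        unfolding inprod_def \<omega>'_def sum_distrib_left by (simp add: mult_ac)
      then show ?thesis
        using w_compl[OF that] by simp
    qed
    have "grad_L f p h r m g xs \<mu>' \<omega>' = (1 / \<tau>) *\<^sub>R (\<tau> *\<^sub>R grad f xs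
        + (\<Sum>i<p. u i *\<^sub>R grad (\<lambda>y. h y i) xs) - (\<Sum>i<r. DT_app (m i) (g i) xs (w i)))"
      using \<tau>0 by (simp only: grad_L_def grad_lagrangian[OF f h g] \<mu>'_def \<omega>'_def[abs_def]
          DT_app_scale scaleR_add_right scaleR_diff_right scaleR_sum_right scaleR_scaleR) simp
    then show "grad_L f p h r m g xs \<mu>' \<omega>' = 0"
      by (simp only: stat scaleR_zero_right)
  qed (rule feas)
  ultimately show ?thesis
    using \<phi>(1) that by blast
qed

section \<open>The second-order condition in the limit\<close>

lemma vB_tendsto:
  assumes "\<forall>j<m i. twice_cont_diff (\<lambda>x. g i x j)" and "(X \<longlongrightarrow> x) F"
  shows "((\<lambda>k. vB m g i (X k)) \<longlongrightarrow> vB m g i x) F"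
proof -
  have lim: "((\<lambda>k. g i (X k) j) \<longlongrightarrow> g i x j) F" if "j < m i" for j
    using twice_cont_diff_tendsto(1)[OF _ assms(2)] assms(1) that by blast
  have "((\<lambda>k. Gam (tilde (m i) (g i (X k))) j) \<longlongrightarrow> Gam (tilde (m i) (g i x)) j) F"
    if "j < m i" for j
    using that lim by (cases "j = 0") (auto simp: Gam_def tilde_def intro!: tendsto_minus tendsto_tail_norm)
  then show ?thesis
    unfolding vB_def by (intro tendsto_DT_app assms)
qed

text \<open>
  At the reference point the cone value lies on the boundary, where it coincides with its
  modification \<open>tilde\<close>; so the vector in the constant rank family induces the linear form of
  the critical subspace.
\<close>

lemma vB_inner_boundary:
  assumes "i \<in> IB r m g x"
  shows "vB m g i x \<bullet> d = inprod (m i) (g i x) (Gam (D_app (g i) x d))"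
proof -
  have "tilde (m i) (g i x) = g i x"
    using assms by (auto simp: IB_def soc_bd_def tilde_def)
  then have "vB m g i x \<bullet> d = inprod (m i) (D_app (g i) x d) (Gam (g i x))"
    using inner_DT_app[of d "m i" "g i" x] by (simp add: vB_def inner_commute)
  also have "\<dots> = inprod (m i) (g i x) (Gam (D_app (g i) x d))"
    unfolding inprod_def by (rule sum.cong) (auto simp: Gam_def)
  finally show ?thesis .
qed

lemma finite_active: "finite (I0 r m g x)" "finite (IB r m g x)"
  by (auto simp: I0_def IB_def)

text \<open>
  Reading the members of the family as functions of the point makes the family at every point
  the image of one index set.
\<close>

lemma wcr_approximation:
  assumes h: "\<forall>i<p. twice_cont_diff (\<lambda>x. h x i)"
    and g: "\<forall>i<r. \<forall>j<m i. twice_cont_diff (\<lambda>x. g i x j)"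
    and wcr: "WCR p h r m g xs" and X: "X \<longlonglongrightarrow> xs"
    and d: "d \<in> crit_subspace p h r m g xs"
  obtains D where "D \<longlonglongrightarrow> d"
    and "\<And>k i. i < p \<Longrightarrow> D_app h (X k) (D k) i = 0"
    and "\<And>k i j. i \<in> I0 r m g xs \<Longrightarrow> j < m i \<Longrightarrow> D_app (g i) (X k) (D k) j = 0"
    and "\<And>k i. i \<in> IB r m g xs \<Longrightarrow> vB m g i (X k) \<bullet> D k = 0"
proof -
  define A where "A = (\<lambda>i. grad (\<lambda>y. h y i)) ` {..<p}
    \<union> (\<lambda>(i, j). grad (\<lambda>y. g i y j)) ` (SIGMA i:I0 r m g xs. {..<m i})
    \<union> (\<lambda>i. vB m g i) ` IB r m g xs"
  have family: "wcr_family p h r m g xs x = (\<lambda>V. V x) ` A" for x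
    unfolding wcr_family_def A_def by (auto simp: image_Un image_image) force
  have finA: "finite A"
    unfolding A_def by (auto simp: finite_active)
  have lim: "(\<lambda>k. V (X k)) \<longlonglongrightarrow> V xs" if "V \<in> A" for V
    using that h g unfolding A_def
    by (auto simp: I0_def IB_def intro!: twice_cont_diff_tendsto(2)[OF _ X] vB_tendsto X)
  have orth: "V xs \<bullet> d = 0" if "V \<in> A" for V
    using that d unfolding A_def crit_subspace_def by (auto simp: vB_inner_boundary D_app_def)
  obtain N rk where N: "open N" "xs \<in> N" "\<forall>x\<in>N. dim (wcr_family p h r m g xs x) = rk"
    using wcr by (auto simp: WCR_def)
  have "\<forall>\<^sub>F k in sequentially. X k \<in> N"
    using X N(1,2) by (rule topological_tendstoD)
  then have rank: "\<forall>\<^sub>F k in sequentially. dim ((\<lambda>V. V (X k)) ` A) \<le> dim ((\<lambda>V. V xs) ` A)"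
    by (rule eventually_mono) (use N(2,3) in \<open>simp add: family\<close>)
  obtain D where D: "D \<longlonglongrightarrow> d" "\<And>k V. V \<in> A \<Longrightarrow> V (X k) \<bullet> D k = 0"
  proof (rule orthogonal_approximation[where u = "\<lambda>V. V xs" and v = "\<lambda>k V. V (X k)"
        and F = sequentially, OF finA _ rank])
    show "(\<lambda>k. V (X k)) \<longlonglongrightarrow> V xs" "V xs \<bullet> d = 0" if "V \<in> A" for V
      using lim orth that by auto
  qed blast
  show ?thesis
  proof (rule that[OF D(1)])
    show "D_app h (X k) (D k) i = 0" if "i < p" for k i
      unfolding D_app_def using that by (intro D(2)) (auto simp: A_def)
    show "D_app (g i) (X k) (D k) j = 0" if "i \<in> I0 r m g xs" "j < m i" for k i j
      unfolding D_app_def using that by (intro D(2)) (force simp: A_def)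
    show "vB m g i (X k) \<bullet> D k = 0" if "i \<in> IB r m g xs" for k i
      using that by (intro D(2)) (auto simp: A_def)
  qed
qed

lemma tendsto_hess_L_quadratic_form:
  assumes f: "twice_cont_diff f" and h: "\<forall>i<p. twice_cont_diff (\<lambda>x. h x i)"
    and g: "\<forall>i<r. \<forall>j<m i. twice_cont_diff (\<lambda>x. g i x j)"
    and X: "(X \<longlongrightarrow> x) F" and D: "(D \<longlongrightarrow> d) F"
    and \<mu>: "\<And>i. i < p \<Longrightarrow> ((\<lambda>k. \<mu> k i) \<longlongrightarrow> \<mu>' i) F"
    and \<omega>: "\<And>i j. i < r \<Longrightarrow> j < m i \<Longrightarrow> ((\<lambda>k. \<omega> k i j) \<longlongrightarrow> \<omega>' i j) F"
  shows "((\<lambda>k. D k \<bullet> (hess_L f p h r m g (X k) (\<mu> k) (\<omega> k) *v D k)) \<longlongrightarrow>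
    d \<bullet> (hess_L f p h r m g x \<mu>' \<omega>' *v d)) F"
  unfolding hess_L_quadratic_form[OF f h g]
  using f h g \<mu> \<omega>
  by (intro tendsto_add tendsto_diff tendsto_sum tendsto_mult tendsto_quadratic_form D
      twice_cont_diff_tendsto(3)[OF _ X]) auto

lemma tendsto_sigma_quadratic_form:
  assumes m: "\<forall>i<r. m i \<ge> 1" and g: "\<forall>i<r. \<forall>j<m i. twice_cont_diff (\<lambda>x. g i x j)"
    and X: "(X \<longlongrightarrow> xs) F" and D: "(D \<longlongrightarrow> d) F"
    and \<omega>: "\<And>i j. i < r \<Longrightarrow> j < m i \<Longrightarrow> ((\<lambda>k. \<omega> k i j) \<longlongrightarrow> \<omega>' i j) F"
  shows "((\<lambda>k. D k \<bullet> (sigma r m g xs (X k) (\<omega> k) *v D k)) \<longlongrightarrow>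
    d \<bullet> (sigma r m g xs xs \<omega>' *v d)) F"
  unfolding sigma_quadratic_form
proof (intro tendsto_sum tendsto_mult tendsto_minus tendsto_divide)
  fix i assume i: "i \<in> IB r m g xs"
  then have ir: "i < r" "0 < m i"
    using m by (auto simp: IB_def)
  show "((\<lambda>k. \<omega> k i 0) \<longlongrightarrow> \<omega>' i 0) F"
    using \<omega> ir by blast
  show "((\<lambda>k. g i (X k) 0) \<longlongrightarrow> g i xs 0) F"
    using g ir by (intro twice_cont_diff_tendsto(1)[OF _ X]) auto
  show "g i xs 0 \<noteq> 0"
    using i by (auto simp: IB_def soc_bd_def)
  have D_lim: "((\<lambda>k. D_app (g i) (X k) (D k) j) \<longlongrightarrow> D_app (g i) xs d j) F" if "j < m i" for j
    using g ir that by (intro tendsto_D_app X D) auto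
  have "((\<lambda>k. Gam (D_app (g i) (X k) (D k)) j) \<longlongrightarrow> Gam (D_app (g i) xs d) j) F"
    if "j < m i" for j
    using D_lim[OF that] by (auto simp: Gam_def intro: tendsto_minus)
  then show "((\<lambda>k. inprod (m i) (D_app (g i) (X k) (D k)) (Gam (D_app (g i) (X k) (D k)))) \<longlongrightarrow>
      inprod (m i) (D_app (g i) xs d) (Gam (D_app (g i) xs d))) F"
    unfolding inprod_def using D_lim by (intro tendsto_sum tendsto_mult) auto
qed

theorem theorem4p10:
  fixes f :: "real^'n \<Rightarrow> real"
    and p :: nat and h :: "real^'n \<Rightarrow> nat \<Rightarrow> real"
    and r :: nat and m :: "nat \<Rightarrow> nat" and g :: "nat \<Rightarrow> real^'n \<Rightarrow> nat \<Rightarrow> real"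
    and xs :: "real^'n"
  assumes "\<forall>i<r. m i \<ge> 1"
    and "twice_cont_diff f"
    and "\<forall>i<p. twice_cont_diff (\<lambda>x. h x i)"
    and "\<forall>i<r. \<forall>j<m i. twice_cont_diff (\<lambda>x. g i x j)"
    and "AKKT2 f p h r m g xs"
    and "robinson_cq p h r m g xs"
    and "WCR p h r m g xs"
  shows "\<exists>(\<mu> :: nat \<Rightarrow> real) (\<omega> :: nat \<Rightarrow> nat \<Rightarrow> real).
           (\<forall>i<r. \<omega> i \<in> soc (m i)) \<and> WSONC f p h r m g xs \<mu> \<omega>"
proof -
  note m = assms(1) and f = assms(2) and h = assms(3) and g = assms(4)
  obtain X \<mu> \<omega> and \<eta> \<theta> \<gamma> :: "nat \<Rightarrow> nat \<Rightarrow> real" and \<delta>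
    where akkt: "AKKT_seq f p h r m g xs X \<mu> \<omega>" and \<delta>: "\<delta> \<longlonglongrightarrow> 0"
      and psd: "\<forall>\<^sub>F k in sequentially. \<forall>d.
         d \<bullet> ((hess_L f p h r m g (X k) (\<mu> k) (\<omega> k)
               + sigma r m g xs (X k) (\<omega> k)
               + (\<Sum>i<p. \<eta> k i *\<^sub>R outer (grad (\<lambda>y. h y i) (X k)))
               + (\<Sum>i\<in>IB r m g xs. \<gamma> k i *\<^sub>R outer (vB m g i (X k)))
               + (\<Sum>i\<in>I0 r m g xs. \<theta> k i *\<^sub>R
                    matrix (\<lambda>v. DT_app (m i) (g i) (X k) (D_app (g i) (X k) v)))
               + \<delta> k *\<^sub>R mat 1) *v d) \<ge> 0"
    using assms(5) unfolding AKKT2_def by blast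
  obtain \<phi> \<mu>' \<omega>' where \<phi>: "strict_mono \<phi>" and kkt: "KKT_triple f p h r m g xs \<mu>' \<omega>'"
    and \<mu>_lim: "\<And>i. i < p \<Longrightarrow> (\<lambda>k. \<mu> (\<phi> k) i) \<longlonglongrightarrow> \<mu>' i"
    and \<omega>_lim: "\<And>i j. i < r \<Longrightarrow> j < m i \<Longrightarrow> (\<lambda>k. \<omega> (\<phi> k) i j) \<longlonglongrightarrow> \<omega>' i j"
    using AKKT_robinson_imp_KKT[OF m f h g akkt assms(6)] by blast
  have X_lim: "(\<lambda>k. X (\<phi> k)) \<longlonglongrightarrow> xs"
    using AKKT_seq_subseq[OF akkt \<phi>] by (simp add: AKKT_seq_def)
  have \<delta>_lim: "(\<lambda>k. \<delta> (\<phi> k)) \<longlonglongrightarrow> 0"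
    using LIMSEQ_subseq_LIMSEQ[OF \<delta> \<phi>] by (simp add: o_def)
  have "0 \<le> d \<bullet> ((hess_L f p h r m g xs \<mu>' \<omega>' + sigma r m g xs xs \<omega>') *v d)"
    if d: "d \<in> crit_subspace p h r m g xs" for d
  proof -
    obtain D where D: "D \<longlonglongrightarrow> d"
      and h0: "\<And>k i. i < p \<Longrightarrow> D_app h (X (\<phi> k)) (D k) i = 0"
      and g0: "\<And>k i j. i \<in> I0 r m g xs \<Longrightarrow> j < m i \<Longrightarrow> D_app (g i) (X (\<phi> k)) (D k) j = 0"
      and B0: "\<And>k i. i \<in> IB r m g xs \<Longrightarrow> vB m g i (X (\<phi> k)) \<bullet> D k = 0"
      using wcr_approximation[OF h g assms(7) X_lim d] by blast
    let ?q = "\<lambda>k. D k \<bullet> (hess_L f p h r m g (X (\<phi> k)) (\<mu> (\<phi> k)) (\<omega> (\<phi> k)) *v D k)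
        + D k \<bullet> (sigma r m g xs (X (\<phi> k)) (\<omega> (\<phi> k)) *v D k) + \<delta> (\<phi> k) * (D k \<bullet> D k)"
    \<comment> \<open>The penalty terms are zero at \<open>D k\<close>, whatever the size of \<open>\<eta>\<close>, \<open>\<gamma>\<close> and \<open>\<theta>\<close>.\<close>
    have "\<forall>\<^sub>F k in sequentially. 0 \<le> ?q k"
      using eventually_subseq[OF \<phi> psd]
    proof eventually_elim
      case (elim k)
      have "(\<Sum>i<p. \<eta> (\<phi> k) i * (grad (\<lambda>y. h y i) (X (\<phi> k)) \<bullet> D k)\<^sup>2) = 0"
        using h0 by (simp add: D_app_def)
      moreover have "(\<Sum>i\<in>IB r m g xs. \<gamma> (\<phi> k) i * (vB m g i (X (\<phi> k)) \<bullet> D k)\<^sup>2) = 0"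
        using B0 by simp
      moreover have "(\<Sum>i\<in>I0 r m g xs. \<theta> (\<phi> k) i * inprod (m i)
          (D_app (g i) (X (\<phi> k)) (D k)) (D_app (g i) (X (\<phi> k)) (D k))) = 0"
        using g0 by (simp add: inprod_def)
      ultimately show ?case
        using elim[rule_format, of "D k"]
        by (simp add: matrix_vector_mult_add_rdistrib inner_add_right sum_matrix_vector_mult
            inner_sum_right scaleR_matrix_vector_assoc[symmetric] outer_quadratic_form
            DT_app_D_app_quadratic_form)
    qed
    moreover have "?q \<longlonglongrightarrow> d \<bullet> (hess_L f p h r m g xs \<mu>' \<omega>' *v d)
        + d \<bullet> (sigma r m g xs xs \<omega>' *v d) + 0 * (d \<bullet> d)"
      by (intro tendsto_add tendsto_mult tendsto_inner D \<delta>_lim X_lim \<mu>_lim \<omega>_lim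
          tendsto_hess_L_quadratic_form[OF f h g] tendsto_sigma_quadratic_form[OF m g])
    ultimately have "0 \<le> d \<bullet> (hess_L f p h r m g xs \<mu>' \<omega>' *v d)
        + d \<bullet> (sigma r m g xs xs \<omega>' *v d) + 0 * (d \<bullet> d)"
      by (intro tendsto_lowerbound[where F = sequentially]) auto
    then show ?thesis
      by (simp add: matrix_vector_mult_add_rdistrib inner_add_right)
  qed
  then have "WSONC f p h r m g xs \<mu>' \<omega>'"
    using kkt by (simp add: WSONC_def)
  moreover have "\<forall>i<r. \<omega>' i \<in> soc (m i)"
    using kkt by (simp add: KKT_triple_def)
  ultimately show ?thesis
    by blast
qed

end
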